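(* Let $G$ be a locally compact lacunary hyperbolic group, and $N$ a closed normal subgroup of $G$. Assume that $N$ is compactly generated and quasi-isometrically embedded in $G$. Then $N$ is either compact or cocompact in $G$.
   Context: For a locally compact group $G$ with compact generating set $S$, let $|g|_S$ denote the word length and $d_S(g,h)=|g^{-1}h|_S$ the word metric. A scaling sequence $\mathbf{s}=(s_n)$ is a sequence of positive reals tending to infinity. $\mathrm{Precone}(G,\mathbf{s})$ is the group of sequences $(g_n)$ in $G$ for which there is $C>0$ with $|g_n|_S\le C s_n$ for all $n\ge 1$. For a non-principal ultrafilter $\omega$ on $\mathbb{N}$, set $d_\omega((g_n),(h_n))=\lim^\omega d_S(g_n,h_n)/s_n$; the asymptotic cone $\mathrm{Cone}^{\omega}(G,\mathbf{s})$ is the metric space obtained from $\mathrm{Precone}(G,\mathbf{s})$ by identifying elements at $d_\omega$-distance zero (well defined up to bi-Lipschitz homeomorphism, independently of $S$). A locally compact compactly generated group $G$ is lacunary hyperbolic if at least one of its asymptotic cones is a real tree, i.e. a geodesic metric space in which any two points are joined by a unique topological arc. $N$ is quasi-isometrically embedded in $G$ if the inclusion of $N$ (with a word metric of a compact generating set of $N$) into $G$ (with a word metric of a compact generating set of $G$) is a quasi-isometric embedding. *)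

theory Defs
  imports
    "HOL-Analysis.Analysis"
    "HOL-Algebra.Coset"
    "HOL-Algebra.Generated_Groups"
begin

section \<open>Locally compact groups\<close>

locale topological_group = group G for G :: "('a, 'b) monoid_scheme" (structure) +
  fixes X :: "'a topology"
  assumes topspace_eq: "topspace X = carrier G"
    and continuous_mult: "continuous_map (prod_topology X X) X (\<lambda>(x, y). x \<otimes> y)"
    and continuous_inv: "continuous_map X X (\<lambda>x. inv x)"

text \<open>As usual, the Hausdorff axiom is part of the notion of a locally compact group.\<close>

definition locally_compact_group :: "('a, 'b) monoid_scheme \<Rightarrow> 'a topology \<Rightarrow> bool" where
  "locally_compact_group G X \<longleftrightarrow>
     topological_group G X \<and> locally_compact_space X \<and> Hausdorff_space X"

definition compact_generating_set ::
    "('a, 'b) monoid_scheme \<Rightarrow> 'a topology \<Rightarrow> 'a set \<Rightarrow> bool" where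
  "compact_generating_set G X S \<longleftrightarrow> compactin X S \<and> generate G S = carrier G"

definition compactly_generated :: "('a, 'b) monoid_scheme \<Rightarrow> 'a topology \<Rightarrow> bool" where
  "compactly_generated G X \<longleftrightarrow> (\<exists>S. compact_generating_set G X S)"

definition coset_topology ::
    "('a, 'b) monoid_scheme \<Rightarrow> 'a topology \<Rightarrow> 'a set \<Rightarrow> 'a set topology" where
  "coset_topology G X N =
     topology (\<lambda>\<U>. \<U> \<subseteq> rcosets\<^bsub>G\<^esub> N \<and> openin X {x \<in> topspace X. N #>\<^bsub>G\<^esub> x \<in> \<U>})"

definition cocompact_subgroup :: "('a, 'b) monoid_scheme \<Rightarrow> 'a topology \<Rightarrow> 'a set \<Rightarrow> bool" where
  "cocompact_subgroup G X N \<longleftrightarrow> compact_space (coset_topology G X N)"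


section \<open>Word metrics\<close>

definition word_length :: "('a, 'b) monoid_scheme \<Rightarrow> 'a set \<Rightarrow> 'a \<Rightarrow> nat" where
  "word_length G S g =
     (LEAST n. \<exists>xs. length xs = n \<and> set xs \<subseteq> S \<union> m_inv G ` S
                  \<and> foldr (mult G) xs \<one>\<^bsub>G\<^esub> = g)"

definition word_metric :: "('a, 'b) monoid_scheme \<Rightarrow> 'a set \<Rightarrow> 'a \<Rightarrow> 'a \<Rightarrow> real" where
  "word_metric G S g h = real (word_length G S (inv\<^bsub>G\<^esub> g \<otimes>\<^bsub>G\<^esub> h))"

definition quasi_isometric_embedding ::
    "'a set \<Rightarrow> ('a \<Rightarrow> 'a \<Rightarrow> real) \<Rightarrow> 'b set \<Rightarrow> ('b \<Rightarrow> 'b \<Rightarrow> real) \<Rightarrow> ('a \<Rightarrow> 'b) \<Rightarrow> bool" where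
  "quasi_isometric_embedding M d M' d' f \<longleftrightarrow>
     f \<in> M \<rightarrow> M' \<and>
     (\<exists>L\<ge>1. \<exists>C\<ge>0. \<forall>x\<in>M. \<forall>y\<in>M.
        d x y / L - C \<le> d' (f x) (f y) \<and> d' (f x) (f y) \<le> L * d x y + C)"

definition quasi_isometrically_embedded_subgroup ::
    "('a, 'b) monoid_scheme \<Rightarrow> 'a topology \<Rightarrow> 'a set \<Rightarrow> bool" where
  "quasi_isometrically_embedded_subgroup G X N \<longleftrightarrow>
     (\<exists>S T. compact_generating_set G X S \<and>
            compact_generating_set (G\<lparr>carrier := N\<rparr>) (subtopology X N) T \<and>
            quasi_isometric_embedding N (word_metric (G\<lparr>carrier := N\<rparr>) T)
              (carrier G) (word_metric G S) (\<lambda>x. x))"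


section \<open>Asymptotic cones\<close>

definition nonprincipal_ultrafilter :: "nat filter \<Rightarrow> bool" where
  "nonprincipal_ultrafilter \<omega> \<longleftrightarrow>
     \<omega> \<noteq> bot \<and> (\<forall>P. eventually P \<omega> \<or> eventually (\<lambda>n. \<not> P n) \<omega>) \<and> (\<forall>n. \<omega> \<noteq> principal {n})"

text \<open>Sequences are indexed by all of \<^typ>\<open>nat\<close>, starting at 0 instead of 1.\<close>

definition scaling_sequence :: "(nat \<Rightarrow> real) \<Rightarrow> bool" where
  "scaling_sequence s \<longleftrightarrow> (\<forall>n. 0 < s n) \<and> filterlim s at_top sequentially"

definition precone ::
    "('a, 'b) monoid_scheme \<Rightarrow> 'a set \<Rightarrow> (nat \<Rightarrow> real) \<Rightarrow> (nat \<Rightarrow> 'a) set" where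
  "precone G S s =
     {g. (\<forall>n. g n \<in> carrier G) \<and> (\<exists>C>0. \<forall>n. real (word_length G S (g n)) \<le> C * s n)}"

definition precone_dist ::
    "('a, 'b) monoid_scheme \<Rightarrow> 'a set \<Rightarrow> (nat \<Rightarrow> real) \<Rightarrow> nat filter \<Rightarrow>
     (nat \<Rightarrow> 'a) \<Rightarrow> (nat \<Rightarrow> 'a) \<Rightarrow> real" where
  "precone_dist G S s \<omega> g h = Lim \<omega> (\<lambda>n. word_metric G S (g n) (h n) / s n)"

definition asymptotic_cone ::
    "('a, 'b) monoid_scheme \<Rightarrow> 'a set \<Rightarrow> (nat \<Rightarrow> real) \<Rightarrow> nat filter \<Rightarrow> (nat \<Rightarrow> 'a) set set" where
  "asymptotic_cone G S s \<omega> =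
     precone G S s //
       {(g, h). g \<in> precone G S s \<and> h \<in> precone G S s \<and> precone_dist G S s \<omega> g h = 0}"

text \<open>The locale \<^locale>\<open>Metric_space\<close> requires symmetry and nonnegativity of the distance
  also outside the carrier, hence the default value 0.\<close>

definition cone_dist ::
    "('a, 'b) monoid_scheme \<Rightarrow> 'a set \<Rightarrow> (nat \<Rightarrow> real) \<Rightarrow> nat filter \<Rightarrow>
     (nat \<Rightarrow> 'a) set \<Rightarrow> (nat \<Rightarrow> 'a) set \<Rightarrow> real" where
  "cone_dist G S s \<omega> A B =
     (if A \<in> asymptotic_cone G S s \<omega> \<and> B \<in> asymptotic_cone G S s \<omega>
      then (THE r. \<exists>g\<in>A. \<exists>h\<in>B. r = precone_dist G S s \<omega> g h) else 0)"


section \<open>Real trees and lacunary hyperbolic groups\<close>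

definition geodesic_space :: "'a set \<Rightarrow> ('a \<Rightarrow> 'a \<Rightarrow> real) \<Rightarrow> bool" where
  "geodesic_space M d \<longleftrightarrow>
     Metric_space M d \<and>
     (\<forall>x\<in>M. \<forall>y\<in>M. \<exists>\<gamma>. \<gamma> \<in> {0..d x y} \<rightarrow> M \<and> \<gamma> 0 = x \<and> \<gamma> (d x y) = y \<and>
        (\<forall>t\<in>{0..d x y}. \<forall>u\<in>{0..d x y}. d (\<gamma> t) (\<gamma> u) = \<bar>t - u\<bar>))"

definition arc_joining :: "'a topology \<Rightarrow> 'a \<Rightarrow> 'a \<Rightarrow> 'a set \<Rightarrow> bool" where
  "arc_joining X x y A \<longleftrightarrow>
     (\<exists>\<gamma>. embedding_map (top_of_set {0..1::real}) X \<gamma> \<and>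
          \<gamma> 0 = x \<and> \<gamma> 1 = y \<and> A = \<gamma> ` {0..1})"

definition real_tree :: "'a set \<Rightarrow> ('a \<Rightarrow> 'a \<Rightarrow> real) \<Rightarrow> bool" where
  "real_tree M d \<longleftrightarrow>
     geodesic_space M d \<and>
     (\<forall>x\<in>M. \<forall>y\<in>M. x \<noteq> y \<longrightarrow> (\<exists>!A. arc_joining (Metric_space.mtopology M d) x y A))"

definition lacunary_hyperbolic :: "('a, 'b) monoid_scheme \<Rightarrow> 'a topology \<Rightarrow> bool" where
  "lacunary_hyperbolic G X \<longleftrightarrow>
     locally_compact_group G X \<and>
     (\<exists>S s \<omega>. compact_generating_set G X S \<and> scaling_sequence s \<and> nonprincipal_ultrafilter \<omega> \<and>
        real_tree (asymptotic_cone G S s \<omega>) (cone_dist G S s \<omega>))"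


section \<open>Well-definedness\<close>

lemma openin_coset_topology:
  "openin (coset_topology G X N) \<U> \<longleftrightarrow>
     \<U> \<subseteq> rcosets\<^bsub>G\<^esub> N \<and> openin X {x \<in> topspace X. N #>\<^bsub>G\<^esub> x \<in> \<U>}"
proof -
  have "istopology (\<lambda>\<U>. \<U> \<subseteq> rcosets\<^bsub>G\<^esub> N \<and> openin X {x \<in> topspace X. N #>\<^bsub>G\<^esub> x \<in> \<U>})"
    unfolding istopology_def
  proof (intro conjI allI impI)
    fix U V
    assume U: "U \<subseteq> rcosets\<^bsub>G\<^esub> N \<and> openin X {x \<in> topspace X. N #>\<^bsub>G\<^esub> x \<in> U}"
      and V: "V \<subseteq> rcosets\<^bsub>G\<^esub> N \<and> openin X {x \<in> topspace X. N #>\<^bsub>G\<^esub> x \<in> V}"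
    show "U \<inter> V \<subseteq> rcosets\<^bsub>G\<^esub> N" using U by blast
    have "{x \<in> topspace X. N #>\<^bsub>G\<^esub> x \<in> U \<inter> V} =
        {x \<in> topspace X. N #>\<^bsub>G\<^esub> x \<in> U} \<inter> {x \<in> topspace X. N #>\<^bsub>G\<^esub> x \<in> V}" by blast
    then show "openin X {x \<in> topspace X. N #>\<^bsub>G\<^esub> x \<in> U \<inter> V}" using U V by auto
  next
    fix K
    assume K: "\<forall>U\<in>K. U \<subseteq> rcosets\<^bsub>G\<^esub> N \<and> openin X {x \<in> topspace X. N #>\<^bsub>G\<^esub> x \<in> U}"
    show "\<Union>K \<subseteq> rcosets\<^bsub>G\<^esub> N" using K by blast
    have "{x \<in> topspace X. N #>\<^bsub>G\<^esub> x \<in> \<Union>K} =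
        (\<Union>U\<in>K. {x \<in> topspace X. N #>\<^bsub>G\<^esub> x \<in> U})" by blast
    then show "openin X {x \<in> topspace X. N #>\<^bsub>G\<^esub> x \<in> \<Union>K}" using K by auto
  qed
  then show ?thesis by (simp add: coset_topology_def)
qed

lemma (in topological_group) quotient_map_coset_topology:
  "quotient_map X (coset_topology G X N) (\<lambda>x. N #> x)"
proof -
  have im: "(\<lambda>x. N #> x) ` topspace X = rcosets N"
    by (auto simp: RCOSETS_def topspace_eq)
  have "{x \<in> topspace X. N #> x \<in> rcosets N} = topspace X"
    using im by blast
  then have "openin (coset_topology G X N) (rcosets N)"
    by (simp add: openin_coset_topology)
  then have "topspace (coset_topology G X N) = rcosets N"
    by (metis openin_coset_topology openin_subset openin_topspace subset_antisym)
  then show ?thesis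
    by (simp add: quotient_map_def im openin_coset_topology)
qed

lemma (in group) generate_imp_word:
  assumes "S \<subseteq> carrier G" "g \<in> generate G S"
  shows "\<exists>xs. set xs \<subseteq> S \<union> m_inv G ` S \<and> foldr (mult G) xs \<one> = g"
  using assms(2)
proof (induction rule: generate.induct)
  case one
  show ?case by (rule exI[of _ "[]"]) simp
next
  case (incl h)
  then show ?case using assms(1) by (intro exI[of _ "[h]"]) auto
next
  case (inv h)
  then show ?case using assms(1) by (intro exI[of _ "[inv h]"]) auto
next
  case (eng h1 h2)
  then obtain xs ys where xs: "set xs \<subseteq> S \<union> m_inv G ` S" "foldr (mult G) xs \<one> = h1"
    and ys: "set ys \<subseteq> S \<union> m_inv G ` S" "foldr (mult G) ys \<one> = h2" by blast
  have h2: "h2 \<in> carrier G" using eng assms(1) generate_in_carrier by blast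
  have "set xs \<subseteq> carrier G" using xs assms(1) by auto
  then have "foldr (mult G) xs \<one> \<in> carrier G \<and>
      foldr (mult G) xs h2 = foldr (mult G) xs \<one> \<otimes> h2"
    using h2 by (induction xs) (auto simp: m_assoc)
  then show ?case using xs ys by (intro exI[of _ "xs @ ys"]) auto
qed

context group
begin

lemma word_length_word:
  assumes "S \<subseteq> carrier G" "generate G S = carrier G" "g \<in> carrier G"
  obtains xs where "length xs = word_length G S g" "set xs \<subseteq> S \<union> m_inv G ` S"
    "foldr (mult G) xs \<one> = g"
proof -
  have "\<exists>n xs. length xs = n \<and> set xs \<subseteq> S \<union> m_inv G ` S \<and> foldr (mult G) xs \<one> = g"
    using generate_imp_word[OF assms(1)] assms(2,3) by blast
  from LeastI_ex[OF this] show thesis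
    using that unfolding word_length_def by blast
qed

lemma word_length_le:
  assumes "set xs \<subseteq> S \<union> m_inv G ` S" "foldr (mult G) xs \<one> = g"
  shows "word_length G S g \<le> length xs"
  unfolding word_length_def using assms by (intro Least_le) blast

lemma foldr_mult:
  assumes "set xs \<subseteq> carrier G" "h \<in> carrier G"
  shows "foldr (mult G) xs \<one> \<in> carrier G \<and>
      foldr (mult G) xs h = foldr (mult G) xs \<one> \<otimes> h"
  using assms by (induction xs) (auto simp: m_assoc)

lemma word_length_one [simp]: "word_length G S \<one> = 0"
  using word_length_le[of "[]" S \<one>] by simp

lemma word_length_mult_le:
  assumes "S \<subseteq> carrier G" "generate G S = carrier G" "g \<in> carrier G" "h \<in> carrier G"
  shows "word_length G S (g \<otimes> h) \<le> word_length G S g + word_length G S h"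
proof -
  obtain xs where xs: "length xs = word_length G S g" "set xs \<subseteq> S \<union> m_inv G ` S"
    "foldr (mult G) xs \<one> = g" using word_length_word[OF assms(1-3)] .
  obtain ys where ys: "length ys = word_length G S h" "set ys \<subseteq> S \<union> m_inv G ` S"
    "foldr (mult G) ys \<one> = h" using word_length_word[OF assms(1,2,4)] .
  have "set xs \<subseteq> carrier G" using xs assms(1) by auto
  from foldr_mult[OF this assms(4)] have "foldr (mult G) (xs @ ys) \<one> = g \<otimes> h"
    using xs ys by simp
  then have "word_length G S (g \<otimes> h) \<le> length (xs @ ys)"
    using xs ys by (intro word_length_le) auto
  then show ?thesis using xs ys by simp
qed

lemma word_length_inv_le:
  assumes "S \<subseteq> carrier G" "generate G S = carrier G" "g \<in> carrier G"
  shows "word_length G S (inv g) \<le> word_length G S g"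
proof -
  obtain xs where xs: "length xs = word_length G S g" "set xs \<subseteq> S \<union> m_inv G ` S"
    "foldr (mult G) xs \<one> = g" using word_length_word[OF assms] .
  define ys where "ys = rev (map (m_inv G) xs)"
  have ys: "set ys \<subseteq> S \<union> m_inv G ` S" using xs assms(1) by (auto simp: ys_def subset_iff)
  have "set xs \<subseteq> carrier G" using xs assms(1) by auto
  then have "foldr (mult G) (rev (map (m_inv G) xs)) \<one> = inv (foldr (mult G) xs \<one>)"
  proof (induction xs)
    case (Cons x xs)
    then have c: "set (rev (map (m_inv G) xs)) \<subseteq> carrier G" "inv x \<in> carrier G" by auto
    show ?case using Cons foldr_mult[OF c] foldr_mult[of xs \<one>] by (simp add: inv_mult_group)
  qed simp
  then have "word_length G S (inv g) \<le> length ys"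
    using xs ys by (intro word_length_le) (auto simp: ys_def)
  then show ?thesis using xs by (simp add: ys_def)
qed

lemma word_length_inv:
  assumes "S \<subseteq> carrier G" "generate G S = carrier G" "g \<in> carrier G"
  shows "word_length G S (inv g) = word_length G S g"
  using word_length_inv_le[OF assms] word_length_inv_le[OF assms(1,2), of "inv g"] assms(3)
  by simp

lemma word_metric_commute:
  assumes "S \<subseteq> carrier G" "generate G S = carrier G" "g \<in> carrier G" "h \<in> carrier G"
  shows "word_metric G S g h = word_metric G S h g"
  using word_length_inv[OF assms(1,2), of "inv g \<otimes> h"] assms(3,4)
  by (simp add: word_metric_def inv_mult_group)

lemma word_metric_triangle:
  assumes "S \<subseteq> carrier G" "generate G S = carrier G"
    "g \<in> carrier G" "h \<in> carrier G" "k \<in> carrier G"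
  shows "word_metric G S g k \<le> word_metric G S g h + word_metric G S h k"
proof -
  have "(inv g \<otimes> h) \<otimes> (inv h \<otimes> k) = inv g \<otimes> k"
    using assms(3-5) by (metis inv_closed inv_solve_left m_assoc m_closed)
  then show ?thesis
    using word_length_mult_le[OF assms(1,2), of "inv g \<otimes> h" "inv h \<otimes> k"] assms(3-5)
    by (simp add: word_metric_def flip: of_nat_add)
qed

lemma word_metric_le:
  assumes "S \<subseteq> carrier G" "generate G S = carrier G" "g \<in> carrier G" "h \<in> carrier G"
  shows "word_metric G S g h \<le> real (word_length G S g) + real (word_length G S h)"
  using word_length_mult_le[OF assms(1,2), of "inv g" h] word_length_inv[OF assms(1-3)] assms
  by (simp add: word_metric_def flip: of_nat_add)

end

lemma ultrafilter_tendsto_Lim: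
  fixes f :: "nat \<Rightarrow> real"
  assumes "nonprincipal_ultrafilter \<omega>" and bnd: "\<And>n. f n \<in> {a..b}"
  shows "(f \<longlongrightarrow> Lim \<omega> f) \<omega>"
proof -
  have nb: "\<omega> \<noteq> bot" and ultra: "\<And>P. eventually P \<omega> \<or> eventually (\<lambda>n. \<not> P n) \<omega>"
    using assms(1) by (auto simp: nonprincipal_ultrafilter_def)
  have "filtermap f \<omega> \<noteq> bot" using nb by (simp add: filtermap_bot_iff)
  moreover have "eventually (\<lambda>x. x \<in> {a..b}) (filtermap f \<omega>)"
    using bnd by (simp add: eventually_filtermap)
  ultimately obtain l where l: "inf (nhds l) (filtermap f \<omega>) \<noteq> bot"
    using compact_Icc[of a b] unfolding compact_filter by blast
  have "(f \<longlongrightarrow> l) \<omega>"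
  proof (rule topological_tendstoI)
    fix U assume U: "open U" "l \<in> U"
    show "eventually (\<lambda>n. f n \<in> U) \<omega>"
    proof (rule ccontr)
      assume "\<not> ?thesis"
      then have "eventually (\<lambda>x. x \<notin> U) (filtermap f \<omega>)"
        using ultra[of "\<lambda>n. f n \<in> U"] by (simp add: eventually_filtermap)
      moreover have "eventually (\<lambda>x. x \<in> U) (nhds l)" using U by (rule eventually_nhds_in_open)
      ultimately have "eventually (\<lambda>x. False) (inf (nhds l) (filtermap f \<omega>))"
        unfolding eventually_inf by blast
      then show False using l by (simp add: trivial_limit_def)
    qed
  qed
  moreover from tendsto_Lim[OF nb this] have "Lim \<omega> f = l" .
  ultimately show ?thesis by simp
qed

locale asymptotic_cone_data = group G for G :: "('a, 'b) monoid_scheme" (structure) +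
  fixes S :: "'a set" and s :: "nat \<Rightarrow> real" and \<omega> :: "nat filter"
  assumes S: "S \<subseteq> carrier G" "generate G S = carrier G"
    and s: "scaling_sequence s" and \<omega>: "nonprincipal_ultrafilter \<omega>"
begin

abbreviation "P \<equiv> precone G S s"
abbreviation "D \<equiv> precone_dist G S s \<omega>"

lemma \<omega>_nontrivial: "\<omega> \<noteq> bot"
  using \<omega> by (simp add: nonprincipal_ultrafilter_def)

lemma s_pos: "0 < s n"
  using s by (simp add: scaling_sequence_def)

lemma P_carrier: "g \<in> P \<Longrightarrow> g n \<in> carrier G"
  by (simp add: precone_def)

lemma precone_dist_tendsto:
  assumes "g \<in> P" "h \<in> P"
  shows "((\<lambda>n. word_metric G S (g n) (h n) / s n) \<longlongrightarrow> D g h) \<omega>"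
proof -
  obtain C where C: "\<And>n. real (word_length G S (g n)) \<le> C * s n"
    using assms(1) by (auto simp: precone_def)
  obtain C' where C': "\<And>n. real (word_length G S (h n)) \<le> C' * s n"
    using assms(2) by (auto simp: precone_def)
  have "word_metric G S (g n) (h n) / s n \<in> {0..C + C'}" for n
  proof -
    have "word_metric G S (g n) (h n) \<le> (C + C') * s n"
      using word_metric_le[OF S P_carrier[OF assms(1)] P_carrier[OF assms(2)], of n n]
        C[of n] C'[of n] by (simp add: algebra_simps)
    then show ?thesis using s_pos[of n] by (simp add: word_metric_def pos_divide_le_eq)
  qed
  then show ?thesis
    unfolding precone_dist_def by (rule ultrafilter_tendsto_Lim[OF \<omega>])
qed

lemma D_nonneg:
  assumes "g \<in> P" "h \<in> P" shows "0 \<le> D g h"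
proof (rule tendsto_lowerbound[OF precone_dist_tendsto[OF assms] _ \<omega>_nontrivial])
  show "eventually (\<lambda>n. 0 \<le> word_metric G S (g n) (h n) / s n) \<omega>"
    using s_pos by (auto simp: word_metric_def less_imp_le intro!: always_eventually)
qed

lemma D_self: "g \<in> P \<Longrightarrow> D g g = 0"
  using \<omega>_nontrivial P_carrier[of g]
  by (simp add: precone_dist_def word_metric_def tendsto_Lim)

lemma D_commute: "g \<in> P \<Longrightarrow> h \<in> P \<Longrightarrow> D g h = D h g"
  unfolding precone_dist_def using word_metric_commute[OF S P_carrier P_carrier] by simp

lemma D_triangle:
  assumes "g \<in> P" "h \<in> P" "k \<in> P" shows "D g k \<le> D g h + D h k"
proof (rule tendsto_le[OF \<omega>_nontrivial
      tendsto_add[OF precone_dist_tendsto[OF assms(1,2)] precone_dist_tendsto[OF assms(2,3)]]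
      precone_dist_tendsto[OF assms(1,3)]], rule always_eventually, rule allI)
  fix n
  show "word_metric G S (g n) (k n) / s n
      \<le> word_metric G S (g n) (h n) / s n + word_metric G S (h n) (k n) / s n"
    using word_metric_triangle[OF S, of "g n" "h n" "k n"] assms P_carrier s_pos[of n]
    by (simp add: divide_right_mono flip: add_divide_distrib)
qed

definition R :: "((nat \<Rightarrow> 'a) \<times> (nat \<Rightarrow> 'a)) set" where
  "R = {(g, h). g \<in> P \<and> h \<in> P \<and> D g h = 0}"

lemma asymptotic_cone_eq: "asymptotic_cone G S s \<omega> = P // R"
  by (simp add: asymptotic_cone_def R_def)

lemma equiv_R: "equiv P R"
proof (rule equivI)
  show "R \<subseteq> P \<times> P" by (auto simp: R_def)
  show "refl_on P R" by (auto simp: refl_on_def R_def D_self)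
  show "sym R" by (auto simp: sym_def R_def D_commute)
  show "trans R"
  proof (rule transI, clarsimp simp: R_def)
    fix g h k assume "g \<in> P" "h \<in> P" "k \<in> P" "D g h = 0" "D h k = 0"
    then show "D g k = 0" using D_triangle[of g h k] D_nonneg[of g k] by simp
  qed
qed

lemma cone_dist_classes:
  assumes "g \<in> P" "h \<in> P"
  shows "cone_dist G S s \<omega> (R `` {g}) (R `` {h}) = D g h"
proof -
  have eq: "D g' h' = D g h" if "g' \<in> R `` {g}" "h' \<in> R `` {h}" for g' h'
  proof -
    have *: "g' \<in> P" "h' \<in> P" "D g g' = 0" "D h h' = 0" using that by (auto simp: R_def)
    show ?thesis
      using D_triangle[of g g' h] D_triangle[of g' h' h] D_triangle[of g' g h']
        D_triangle[of g h h'] D_commute[of g g'] D_commute[of h h'] * assms by linarith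
  qed
  have "g \<in> R `` {g}" "h \<in> R `` {h}" using assms by (auto simp: R_def D_self)
  then have "(THE r. \<exists>g'\<in>R `` {g}. \<exists>h'\<in>R `` {h}. r = D g' h') = D g h"
    using eq by (intro the_equality) blast+
  moreover have "R `` {g} \<in> asymptotic_cone G S s \<omega>" "R `` {h} \<in> asymptotic_cone G S s \<omega>"
    using assms by (simp_all add: asymptotic_cone_eq quotientI)
  ultimately show ?thesis unfolding cone_dist_def by simp
qed

lemma asymptotic_coneE:
  assumes "A \<in> asymptotic_cone G S s \<omega>"
  obtains g where "g \<in> P" "A = R `` {g}"
  using assms that by (auto simp: asymptotic_cone_eq elim: quotientE)

theorem Metric_space_asymptotic_cone:
  "Metric_space (asymptotic_cone G S s \<omega>) (cone_dist G S s \<omega>)"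
proof
  fix A B
  consider g h where "g \<in> P" "A = R `` {g}" "h \<in> P" "B = R `` {h}"
    | "cone_dist G S s \<omega> A B = 0" "cone_dist G S s \<omega> B A = 0"
  proof (cases "A \<in> asymptotic_cone G S s \<omega> \<and> B \<in> asymptotic_cone G S s \<omega>")
    case True
    then show thesis using that(1) by (blast elim: asymptotic_coneE)
  next
    case False
    then show thesis using that(2) by (auto simp: cone_dist_def)
  qed
  then have "0 \<le> cone_dist G S s \<omega> A B \<and> cone_dist G S s \<omega> A B = cone_dist G S s \<omega> B A"
    by cases (auto simp: cone_dist_classes D_nonneg D_commute)
  then show "0 \<le> cone_dist G S s \<omega> A B" "cone_dist G S s \<omega> A B = cone_dist G S s \<omega> B A"
    by auto
next
  fix A B assume "A \<in> asymptotic_cone G S s \<omega>" "B \<in> asymptotic_cone G S s \<omega>"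
  then obtain g h where g: "g \<in> P" "A = R `` {g}" and h: "h \<in> P" "B = R `` {h}"
    by (blast elim: asymptotic_coneE)
  have "R `` {g} = R `` {h} \<longleftrightarrow> (g, h) \<in> R"
    using eq_equiv_class_iff[OF equiv_R g(1) h(1)] .
  moreover have "(g, h) \<in> R \<longleftrightarrow> D g h = 0"
    using g h by (simp add: R_def)
  ultimately show "cone_dist G S s \<omega> A B = 0 \<longleftrightarrow> A = B"
    using g h by (simp add: cone_dist_classes)
next
  fix A B C
  assume "A \<in> asymptotic_cone G S s \<omega>" "B \<in> asymptotic_cone G S s \<omega>"
    "C \<in> asymptotic_cone G S s \<omega>"
  then obtain g h k where "g \<in> P" "A = R `` {g}" "h \<in> P" "B = R `` {h}" "k \<in> P" "C = R `` {k}"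
    by (blast elim: asymptotic_coneE)
  then show "cone_dist G S s \<omega> A C \<le> cone_dist G S s \<omega> A B + cone_dist G S s \<omega> B C"
    using D_triangle by (simp add: cone_dist_classes)
qed

end

end

theory Submission
  imports Defs
begin

text \<open>
  Suppose that \<open>N\<close> is neither compact nor cocompact, and let \<open>P\<^sub>N\<close> be the group of sequences in \<open>N\<close> that
  lie in the precone of \<open>G\<close>. Its orbit of the base point of the cone is connected, since \<open>N\<close> is
  compactly generated and undistorted, and has more than one point, since \<open>N\<close> is not compact. As
  \<open>N\<close> is not cocompact, there is \<open>g\<close> in the precone whose distance to the base point is positive and
  minimal in \<open>P\<^sub>N g\<close>. By normality \<open>P\<^sub>N g = g P\<^sub>N\<close>, so that the orbits of the base point under
  \<open>P\<^sub>N\<close> and \<open>g P\<^sub>N\<close> are disjoint subtrees preserved by \<open>P\<^sub>N\<close>. The bridge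
  joining them is then fixed by \<open>P\<^sub>N\<close>, which contradicts transitivity of \<open>P\<^sub>N\<close> on the first subtree.

  All metric arguments use only the four-point inequality of a real tree, applied to the
  pseudometric on the precone.
\<close>

section \<open>Four-point inequality in real trees\<close>

context Metric_space
begin

text \<open>An injective continuous map from a compact interval to a Hausdorff space is an
  embedding; rescaling by \<open>L\<close> gives the domain \<open>{0..1}\<close> of
  \<open>arc_joining\<close>. A Lipschitz bound, weaker than isometry, also admits broken paths made
  of two geodesics.\<close>

lemma arc_joining_lipschitz:
  assumes L: "L > 0" and f: "f \<in> {0..L} \<rightarrow> M"
    and lip: "\<And>s t. s \<in> {0..L} \<Longrightarrow> t \<in> {0..L} \<Longrightarrow> d (f s) (f t) \<le> \<bar>s - t\<bar>"
    and inj: "inj_on f {0..L}"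
  shows "arc_joining mtopology (f 0) (f L) (f ` {0..L})"
proof -
  define h where "h = (\<lambda>t. f (t * L))"
  have scale: "(\<lambda>t. t * L) ` {0..1} = {0..L}"
    using L image_mult_atLeastAtMost[of L 0 1] by (simp add: mult.commute)
  have mem: "t * L \<in> {0..L}" if "t \<in> {0..1}" for t
    using scale that by blast
  have "continuous_map (top_of_set {0..1}) mtopology h"
    unfolding continuous_map_to_metric
  proof (intro ballI allI impI)
    fix x r :: real
    assume x: "x \<in> topspace (top_of_set {0..1})" and r: "r > 0"
    show "\<exists>U. openin (top_of_set {0..1}) U \<and> x \<in> U \<and> (\<forall>y\<in>U. h y \<in> mball (h x) r)"
    proof (intro exI[of _ "{0..1} \<inter> ball x (r / L)"] conjI ballI)
      fix y assume y: "y \<in> {0..1} \<inter> ball x (r / L)"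
      have "d (h x) (h y) \<le> \<bar>x * L - y * L\<bar>"
        unfolding h_def using x y mem by (intro lip) auto
      also have "\<dots> = \<bar>x - y\<bar> * L"
        using L by (simp add: abs_mult flip: left_diff_distrib)
      also have "\<dots> < r"
        using y L by (simp add: dist_real_def pos_less_divide_eq)
      finally show "h y \<in> mball (h x) r"
        using x y mem f by (auto simp: h_def Pi_iff)
    qed (use x r L in \<open>auto simp: openin_open\<close>)
  qed
  moreover have "inj_on h {0..1}"
  proof (rule inj_onI)
    fix t u assume "t \<in> {0..1}" "u \<in> {0..1}" "h t = h u"
    then show "t = u"
      using inj_onD[OF inj, of "t * L" "u * L"] mem[of t] mem[of u] L by (simp add: h_def)
  qed
  ultimately have "embedding_map (top_of_set {0..1}) mtopology h"
    by (intro continuous_imp_embedding_map)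
      (auto simp: Hausdorff_space_mtopology compact_space_subtopology)
  moreover have "h ` {0..1} = f ` {0..L}"
    by (simp add: h_def image_image flip: scale)
  ultimately show ?thesis
    unfolding arc_joining_def by (intro exI[of _ h]) (auto simp: h_def)
qed

text \<open>This is the condition that \<open>geodesic_space\<close> puts on
  \<open>\<gamma>\<close>; it forces \<open>x\<close> and \<open>y\<close> to lie in
  \<open>M\<close>.\<close>

definition geodesic_from_to :: "(real \<Rightarrow> 'a) \<Rightarrow> 'a \<Rightarrow> 'a \<Rightarrow> bool" where
  "geodesic_from_to \<gamma> x y \<longleftrightarrow> \<gamma> \<in> {0..d x y} \<rightarrow> M \<and> \<gamma> 0 = x \<and> \<gamma> (d x y) = y \<and>
     (\<forall>t\<in>{0..d x y}. \<forall>u\<in>{0..d x y}. d (\<gamma> t) (\<gamma> u) = \<bar>t - u\<bar>)"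

lemma geodesic_endpoints:
  assumes "geodesic_from_to \<gamma> x y" shows "x \<in> M" "y \<in> M"
proof -
  have "0 \<in> {0..d x y}" "d x y \<in> {0..d x y}"
    by simp_all
  then have "\<gamma> 0 \<in> M" "\<gamma> (d x y) \<in> M"
    using assms unfolding geodesic_from_to_def by blast+
  then show "x \<in> M" "y \<in> M" using assms by (auto simp: geodesic_from_to_def)
qed

lemma geodesic_closed:
  "geodesic_from_to \<gamma> x y \<Longrightarrow> 0 \<le> t \<Longrightarrow> t \<le> d x y \<Longrightarrow> \<gamma> t \<in> M"
  by (auto simp: geodesic_from_to_def)

lemma geodesic_dist:
  "geodesic_from_to \<gamma> x y \<Longrightarrow> t \<in> {0..d x y} \<Longrightarrow> u \<in> {0..d x y} \<Longrightarrow> d (\<gamma> t) (\<gamma> u) = \<bar>t - u\<bar>"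
  by (auto simp: geodesic_from_to_def)

lemma geodesic_dist_start:
  "geodesic_from_to \<gamma> x y \<Longrightarrow> 0 \<le> t \<Longrightarrow> t \<le> d x y \<Longrightarrow> d x (\<gamma> t) = t"
  using geodesic_dist[of \<gamma> x y 0 t] by (auto simp: geodesic_from_to_def)

lemma geodesic_dist_end:
  "geodesic_from_to \<gamma> x y \<Longrightarrow> 0 \<le> t \<Longrightarrow> t \<le> d x y \<Longrightarrow> d (\<gamma> t) y = d x y - t"
  using geodesic_dist[of \<gamma> x y t "d x y"] by (auto simp: geodesic_from_to_def)

lemma geodesic_restrict:
  assumes "geodesic_from_to \<gamma> x y" "0 \<le> t" "t \<le> d x y"
  shows "geodesic_from_to \<gamma> x (\<gamma> t)"
  using assms geodesic_dist_start[OF assms] by (auto simp: geodesic_from_to_def Pi_iff)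

lemma arc_joining_geodesic:
  assumes \<gamma>: "geodesic_from_to \<gamma> x y" and "x \<noteq> y"
  shows "arc_joining mtopology x y (\<gamma> ` {0..d x y})"
proof -
  have "0 < d x y"
    using geodesic_endpoints[OF \<gamma>] assms(2) by simp
  moreover have "inj_on \<gamma> {0..d x y}"
    using geodesic_dist_start[OF \<gamma>] by (intro inj_on_inverseI[where g = "d x"]) auto
  ultimately have "arc_joining mtopology (\<gamma> 0) (\<gamma> (d x y)) (\<gamma> ` {0..d x y})"
    using \<gamma> by (intro arc_joining_lipschitz) (auto simp: geodesic_from_to_def)
  then show ?thesis using \<gamma> by (simp add: geodesic_from_to_def)
qed

section \<open>Unique geodesics, tripods and Gromov products\<close>

context
  assumes tree: "real_tree M d"
begin

lemma geodesic_exists: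
  assumes "x \<in> M" "y \<in> M" obtains \<gamma> where "geodesic_from_to \<gamma> x y"
proof -
  have "\<exists>\<gamma>. geodesic_from_to \<gamma> x y"
    using tree assms unfolding real_tree_def geodesic_space_def geodesic_from_to_def by simp
  then show thesis using that by blast
qed

lemma unique_arc:
  assumes "x \<in> M" "y \<in> M" "x \<noteq> y" "arc_joining mtopology x y A" "arc_joining mtopology x y B"
  shows "A = B"
proof -
  have "\<exists>!A. arc_joining mtopology x y A"
    using tree assms(1-3) unfolding real_tree_def by simp
  then show ?thesis using assms(4,5) by (elim ex1E) metis
qed

text \<open>Both images are arcs with the same ends, hence equal, and a point of either one recovers
  its parameter as its distance from \<open>x\<close>.\<close>

lemma geodesic_unique:
  assumes \<gamma>: "geodesic_from_to \<gamma> x y" and \<gamma>': "geodesic_from_to \<gamma>' x y"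
    and t: "0 \<le> t" "t \<le> d x y"
  shows "\<gamma> t = \<gamma>' t"
proof (cases "x = y")
  case True
  then have "t = 0" using t geodesic_endpoints[OF \<gamma>] by simp
  then show ?thesis using \<gamma> \<gamma>' by (simp add: geodesic_from_to_def)
next
  case False
  have "\<gamma> ` {0..d x y} = \<gamma>' ` {0..d x y}"
    using unique_arc[OF geodesic_endpoints[OF \<gamma>] False
      arc_joining_geodesic[OF \<gamma> False] arc_joining_geodesic[OF \<gamma>' False]] .
  moreover have "\<gamma> t \<in> \<gamma> ` {0..d x y}" using t by simp
  ultimately have "\<gamma> t \<in> \<gamma>' ` {0..d x y}" by simp
  then obtain u where u: "0 \<le> u" "u \<le> d x y" "\<gamma> t = \<gamma>' u" by auto
  then have "u = t"
    using geodesic_dist_start[OF \<gamma> t] geodesic_dist_start[OF \<gamma>' u(1,2)] by simp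
  then show ?thesis using u by simp
qed

text \<open>Up to the common point, both are geodesics with the same endpoints.\<close>

lemma geodesics_agree_before:
  assumes "geodesic_from_to \<gamma> x y" "geodesic_from_to \<gamma>' x z"
    and "\<gamma> t = \<gamma>' t" "0 \<le> u" "u \<le> t" "t \<le> d x y" "t \<le> d x z"
  shows "\<gamma> u = \<gamma>' u"
proof (rule geodesic_unique)
  show "geodesic_from_to \<gamma> x (\<gamma> t)" "geodesic_from_to \<gamma>' x (\<gamma> t)"
    using geodesic_restrict[OF assms(1), of t] geodesic_restrict[OF assms(2), of t] assms
    by simp_all
  show "u \<le> d x (\<gamma> t)"
    using geodesic_dist_start[OF assms(1), of t] assms by simp
qed fact

text \<open>The number \<open>b\<close> is the Gromov product of \<open>y\<close> and
  \<open>z\<close> at \<open>x\<close>. Beyond the last common point the geodesics are disjoint, so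
  going back along one and out along the other traces an arc, which the geodesic from
  \<open>y\<close> to \<open>z\<close> must follow.\<close>

lemma real_tree_tripod:
  assumes \<gamma>: "geodesic_from_to \<gamma> x y" and \<gamma>': "geodesic_from_to \<gamma>' x z"
  obtains b where "0 \<le> b" "b \<le> d x y" "b \<le> d x z" "\<And>t. 0 \<le> t \<Longrightarrow> t \<le> b \<Longrightarrow> \<gamma> t = \<gamma>' t"
    "d y z = (d x y - b) + (d x z - b)"
proof -
  define E where "E = {t. 0 \<le> t \<and> t \<le> d x y \<and> t \<le> d x z \<and> \<gamma> t = \<gamma>' t}"
  define b where "b = Sup E"
  note M = geodesic_endpoints[OF \<gamma>] geodesic_endpoints[OF \<gamma>']
  have E0: "0 \<in> E" using \<gamma> \<gamma>' by (auto simp: E_def geodesic_from_to_def)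
  have bdd: "bdd_above E" by (auto simp: E_def bdd_above_def)
  have upper: "t \<le> b" if "t \<in> E" for t
    unfolding b_def using that bdd by (rule cSup_upper)
  have b: "0 \<le> b" "b \<le> d x y" "b \<le> d x z"
    using upper[OF E0] E0 unfolding b_def by (auto simp: E_def intro!: cSup_least)
  \<comment> \<open>The supremum is attained: elements of \<open>E\<close> come arbitrarily close to
    \<open>b\<close>, and both geodesics have unit speed.\<close>
  have "d (\<gamma> b) (\<gamma>' b) \<le> 0 + e" if "e > 0" for e
  proof -
    have "b - e / 2 < Sup E" using that by (simp add: b_def)
    then obtain t where t: "t \<in> E" "b - e / 2 < t"
      using E0 less_cSupD[of E] by blast
    then have t': "0 \<le> t" "t \<le> d x y" "t \<le> d x z" "\<gamma> t = \<gamma>' t" "t \<le> b"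
      using upper by (auto simp: E_def)
    have "d (\<gamma> b) (\<gamma>' b) \<le> d (\<gamma> b) (\<gamma> t) + d (\<gamma>' t) (\<gamma>' b)"
      using t' triangle[of "\<gamma> b" "\<gamma> t" "\<gamma>' b"] b geodesic_closed[OF \<gamma>] geodesic_closed[OF \<gamma>']
      by simp
    also have "\<dots> = 2 * (b - t)"
      using geodesic_dist[OF \<gamma>, of b t] geodesic_dist[OF \<gamma>', of t b] b t' by simp
    finally show ?thesis using t by simp
  qed
  then have "d (\<gamma> b) (\<gamma>' b) \<le> 0" by (rule field_le_epsilon)
  then have meet: "\<gamma> b = \<gamma>' b"
    using b geodesic_closed[OF \<gamma>, of b] geodesic_closed[OF \<gamma>', of b] nonneg[of "\<gamma> b" "\<gamma>' b"]
    by (simp del: nonneg)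
  have agree: "\<gamma> t = \<gamma>' t" if "0 \<le> t" "t \<le> b" for t
    using geodesics_agree_before[OF \<gamma> \<gamma>' meet] that b by simp
  have "d y z = (d x y - b) + (d x z - b)"
  proof (cases "y = z")
    \<comment> \<open>Arcs are unique only between distinct points, so this case is separate; here
      the geodesics meet at their common end.\<close>
    case True
    then have "d x y \<in> E" using \<gamma> \<gamma>' by (auto simp: E_def geodesic_from_to_def)
    then have "b = d x y" using upper b by fastforce
    then show ?thesis using True M by simp
  next
    case False
    define p where "p = d x y - b"
    define L where "L = p + (d x z - b)"
    \<comment> \<open>The path goes from \<open>y\<close> back along \<open>\<gamma>\<close> to the
      branch point, reached at time \<open>p\<close>, then along \<open>\<gamma>'\<close> to
      \<open>z\<close>; its length is \<open>L\<close>.\<close>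
    define \<eta> where "\<eta> = (\<lambda>u. if u \<le> p then \<gamma> (d x y - u) else \<gamma>' (u - p + b))"
    have p: "0 \<le> p" "p \<le> L" "p \<le> d x y" using b by (auto simp: p_def L_def)
    have \<eta>1: "\<eta> u = \<gamma> (d x y - u)" "0 \<le> d x y - u" "d x y - u \<le> d x y"
      if "0 \<le> u" "u \<le> p" for u
      using that p by (auto simp: \<eta>_def)
    have \<eta>2: "\<eta> u = \<gamma>' (u - p + b)" "0 \<le> u - p + b" "u - p + b \<le> d x z"
      if "p \<le> u" "u \<le> L" for u
      using that meet b by (auto simp: \<eta>_def L_def) (auto simp: p_def)
    have \<eta>M: "\<eta> \<in> {0..L} \<rightarrow> M"
    proof
      fix u assume u: "u \<in> {0..L}"
      show "\<eta> u \<in> M"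
        using \<eta>1[of u] \<eta>2[of u] geodesic_closed[OF \<gamma>] geodesic_closed[OF \<gamma>'] u
        by (cases "u \<le> p") simp_all
    qed
    have ends: "\<eta> 0 = y" "\<eta> L = z"
      using \<eta>1[of 0] \<eta>2[of L] p \<gamma> \<gamma>' by (auto simp: geodesic_from_to_def L_def)
    have d1: "d (\<eta> s) (\<eta> t) = \<bar>s - t\<bar>" if "0 \<le> s" "s \<le> p" "0 \<le> t" "t \<le> p" for s t
      using \<eta>1[of s] \<eta>1[of t] geodesic_dist[OF \<gamma>, of "d x y - s" "d x y - t"] that by simp
    have d2: "d (\<eta> s) (\<eta> t) = \<bar>s - t\<bar>" if "p \<le> s" "s \<le> L" "p \<le> t" "t \<le> L" for s t
      using \<eta>2[of s] \<eta>2[of t] geodesic_dist[OF \<gamma>', of "s - p + b" "t - p + b"] that by simp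
    have lip': "d (\<eta> s) (\<eta> t) \<le> \<bar>s - t\<bar>" if "0 \<le> s" "s \<le> t" "t \<le> L" for s t
    proof -
      consider "t \<le> p" | "p \<le> s" | "s \<le> p" "p \<le> t" by linarith
      then show ?thesis
      proof cases
        case 3
        have "d (\<eta> s) (\<eta> t) \<le> d (\<eta> s) (\<eta> p) + d (\<eta> p) (\<eta> t)"
          using that 3 p \<eta>M by (intro triangle) (auto simp: Pi_iff)
        then show ?thesis using d1[of s p] d2[of p t] that 3 p by simp
      qed (use d1 d2 that in auto)
    qed
    have lip: "d (\<eta> s) (\<eta> t) \<le> \<bar>s - t\<bar>" if "s \<in> {0..L}" "t \<in> {0..L}" for s t
      using lip'[of s t] lip'[of t s] that commute by (cases "s \<le> t") auto
    have inj': "s = t" if "0 \<le> s" "s \<le> t" "t \<le> L" "\<eta> s = \<eta> t" for s t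
    proof -
      have \<eta>d: "d (\<eta> s) (\<eta> t) = 0" using that \<eta>M by (auto simp: Pi_iff)
      consider "t \<le> p" | "p \<le> s" | "s < p" "p < t" by linarith
      then show ?thesis
      proof cases
        \<comment> \<open>A point common to both legs has one distance from \<open>x\<close>, hence
          one parameter on both geodesics. This parameter lies in \<open>E\<close> but exceeds
          \<open>b\<close>.\<close>
        case 3
        note s = \<eta>1[of s] and t = \<eta>2[of t]
        have "d x y - s = t - p + b"
          using geodesic_dist_start[OF \<gamma>, of "d x y - s"] geodesic_dist_start[OF \<gamma>', of "t - p + b"]
            s t that 3 by simp
        then have "t - p + b \<in> E" using s t that 3 by (auto simp: E_def)
        then show ?thesis using upper 3 by fastforce
      qed (use d1[of s t] d2[of s t] \<eta>d that in auto)
    qed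
    have inj: "inj_on \<eta> {0..L}"
    proof (rule inj_onI)
      fix s t assume "s \<in> {0..L}" "t \<in> {0..L}" "\<eta> s = \<eta> t"
      then show "s = t" using inj'[of s t] inj'[of t s] by (cases "s \<le> t") auto
    qed
    have "L \<noteq> 0"
    proof
      assume "L = 0"
      then have "\<eta> 0 = \<eta> L" by simp
      then show False using ends False by simp
    qed
    then have "L > 0" using p by simp
    then have arc: "arc_joining mtopology y z (\<eta> ` {0..L})"
      using arc_joining_lipschitz[OF _ \<eta>M lip inj] ends by simp
    obtain \<sigma> where \<sigma>: "geodesic_from_to \<sigma> y z" using geodesic_exists M by blast
    \<comment> \<open>The branch point lies on \<open>\<sigma>\<close>, so its distances
      \<open>p\<close> and \<open>L - p\<close> to the two ends add up to
      \<open>d y z\<close>.\<close>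
    have "\<eta> ` {0..L} = \<sigma> ` {0..d y z}"
      using unique_arc[OF M(2,4) False arc arc_joining_geodesic[OF \<sigma> False]] .
    moreover have "\<eta> p \<in> \<eta> ` {0..L}" using p by simp
    ultimately have "\<eta> p \<in> \<sigma> ` {0..d y z}" by simp
    then obtain v where v: "0 \<le> v" "v \<le> d y z" "\<eta> p = \<sigma> v" by auto
    have "d y (\<eta> p) = v" "d (\<eta> p) z = d y z - v"
      using geodesic_dist_start[OF \<sigma> v(1,2)] geodesic_dist_end[OF \<sigma> v(1,2)] v by auto
    moreover have "d y (\<eta> p) = p" "d (\<eta> p) z = L - p"
      using d1[of 0 p] d2[of p L] p ends by auto
    ultimately show ?thesis by (simp add: L_def p_def)
  qed
  then show thesis using that b agree by blast
qed

text \<open>The Gromov product of \<open>y\<close> and \<open>z\<close> at \<open>x\<close> is at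
  least the minimum of their products with \<open>w\<close>: both \<open>\<alpha>\<close> and
  \<open>\<beta>\<close> follow \<open>\<gamma>\<close> up to the smaller of the branching times
  \<open>b\<close> and \<open>c\<close>. Written in distances, this is the claim.\<close>

theorem real_tree_four_point:
  assumes "x \<in> M" "y \<in> M" "z \<in> M" "w \<in> M"
  shows "d x w + d y z \<le> max (d x z + d y w) (d x y + d w z)"
proof -
  obtain \<alpha> \<beta> \<gamma> where g: "geodesic_from_to \<alpha> x y" "geodesic_from_to \<beta> x z" "geodesic_from_to \<gamma> x w"
    using geodesic_exists[OF assms(1,2)] geodesic_exists[OF assms(1,3)]
      geodesic_exists[OF assms(1,4)] by metis
  obtain b where b: "0 \<le> b" "b \<le> d x y" "b \<le> d x w" "\<And>t. 0 \<le> t \<Longrightarrow> t \<le> b \<Longrightarrow> \<alpha> t = \<gamma> t"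
    "d y w = (d x y - b) + (d x w - b)"
    using real_tree_tripod[OF g(1,3)] by blast
  obtain c where c: "0 \<le> c" "c \<le> d x w" "c \<le> d x z" "\<And>t. 0 \<le> t \<Longrightarrow> t \<le> c \<Longrightarrow> \<gamma> t = \<beta> t"
    "d w z = (d x w - c) + (d x z - c)"
    using real_tree_tripod[OF g(3,2)] by blast
  define t where "t = min b c"
  have t: "0 \<le> t" "t \<le> d x y" "t \<le> d x z" "\<alpha> t = \<beta> t"
    using b c by (auto simp: t_def)
  have "d y z \<le> d y (\<alpha> t) + d (\<beta> t) z"
    using t triangle[of y "\<alpha> t" z] geodesic_closed[OF g(1) t(1,2)] assms by simp
  also have "\<dots> = (d x y - t) + (d x z - t)"
    using geodesic_dist_end[OF g(1) t(1,2)] geodesic_dist_end[OF g(2) t(1,3)]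
    by (simp add: commute)
  finally show ?thesis using b(5) c(5) by (auto simp: t_def max_def min_def split: if_splits)
qed

end
end

section \<open>Word metrics on locally compact groups\<close>

lemma locally_bounded_imp_bounded_on_compact:
  assumes K: "compactin X K" and "\<And>x. x \<in> K \<Longrightarrow> openin X (U x) \<and> x \<in> U x"
    and bound: "\<And>x. x \<in> K \<Longrightarrow> \<exists>k. \<forall>y\<in>U x. f y \<le> k"
  shows "\<exists>k::nat. \<forall>x\<in>K. f x \<le> k"
proof -
  have "\<exists>\<F>. finite \<F> \<and> \<F> \<subseteq> U ` K \<and> K \<subseteq> \<Union>\<F>"
    using assms(2) by (intro compactinD[OF K]) blast+
  then obtain F where F: "finite F" "F \<subseteq> K" "K \<subseteq> (\<Union>x\<in>F. U x)"
    by (metis finite_subset_image)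
  obtain b where b: "\<And>x y. x \<in> K \<Longrightarrow> y \<in> U x \<Longrightarrow> f y \<le> b x"
    using bound by metis
  \<comment> \<open>A sum of bounds replaces their maximum, which an empty cover would not
    have.\<close>
  have "f y \<le> (\<Sum>x\<in>F. b x)" if y: "y \<in> K" for y
  proof -
    obtain x where x: "x \<in> F" "y \<in> U x" using F y by blast
    then have "f y \<le> b x" using b F by blast
    also have "\<dots> \<le> (\<Sum>x\<in>F. b x)" using F x by (intro member_le_sum) auto
    finally show ?thesis .
  qed
  then show ?thesis by blast
qed

section \<open>Words and coset representatives\<close>

context group
begin

lemma word_length_Cons_le:
  assumes "S \<subseteq> carrier G" "generate G S = carrier G" "x \<in> S \<union> m_inv G ` S" "g \<in> carrier G"
  shows "word_length G S (x \<otimes> g) \<le> Suc (word_length G S g)"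
proof -
  have x: "x \<in> carrier G" using assms by auto
  have "word_length G S x \<le> length [x]" using assms x by (intro word_length_le) auto
  then show ?thesis using word_length_mult_le[OF assms(1,2) x assms(4)] by simp
qed

lemma word_length_Suc_split:
  assumes "S \<subseteq> carrier G" "generate G S = carrier G" "g \<in> carrier G"
    and "word_length G S g = Suc m"
  obtains x h where "x \<in> S \<union> m_inv G ` S" "h \<in> carrier G" "g = x \<otimes> h" "word_length G S h \<le> m"
proof -
  obtain xs where xs: "length xs = Suc m" "set xs \<subseteq> S \<union> m_inv G ` S" "foldr (mult G) xs \<one> = g"
    using word_length_word[OF assms(1-3)] assms(4) by metis
  then obtain x ys where ys: "xs = x # ys" by (cases xs) auto
  have "set ys \<subseteq> carrier G" using xs ys assms(1) by auto
  then have "foldr (mult G) ys \<one> \<in> carrier G" using foldr_mult by blast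
  moreover have "word_length G S (foldr (mult G) ys \<one>) \<le> m"
    using word_length_le[of ys S] xs ys by auto
  ultimately show thesis using that xs ys by auto
qed

lemma word_length_foldr_le:
  assumes "S \<subseteq> carrier G" "generate G S = carrier G" "T \<subseteq> carrier G"
    and k: "\<And>x. x \<in> T \<Longrightarrow> word_length G S x \<le> k"
    and xs: "set xs \<subseteq> T \<union> m_inv G ` T"
  shows "word_length G S (foldr (mult G) xs \<one>) \<le> k * length xs"
  using xs
proof (induction xs)
  case (Cons x xs)
  have c: "set xs \<subseteq> carrier G" "x \<in> carrier G" using Cons.prems assms(3) by auto
  have "word_length G S x \<le> k"
    using Cons.prems k word_length_inv[OF assms(1,2)] assms(3) by auto
  then show ?case
    using Cons foldr_mult[OF c(1), of \<one>] c(2)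
      word_length_mult_le[OF assms(1,2) c(2), of "foldr (mult G) xs \<one>"] by simp
qed simp

lemma subgroup_inv_image:
  assumes "subgroup H G" "T \<subseteq> H"
  shows "m_inv (G\<lparr>carrier := H\<rparr>) ` T = m_inv G ` T"
  using assms m_inv_consistent by (intro image_cong) auto

text \<open>A word of minimal length among the representatives of its coset has this property for all
  its suffixes, by normality.\<close>

lemma coset_minimal_element:
  assumes S: "S \<subseteq> carrier G" "generate G S = carrier G" and N: "N \<lhd> G"
    and unbounded: "\<And>k. \<exists>g\<in>carrier G. \<forall>n\<in>N. k < word_length G S (n \<otimes> g)"
  obtains g where "g \<in> carrier G" "word_length G S g = k" "\<And>n. n \<in> N \<Longrightarrow> k \<le> word_length G S (n \<otimes> g)"
proof -
  interpret N: normal N G by fact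
  define Q where "Q = (\<lambda>k g. g \<in> carrier G \<and> word_length G S g = k \<and>
    (\<forall>n\<in>N. k \<le> word_length G S (n \<otimes> g)))"
  have step: "\<exists>h. Q m h" if Q: "Q (Suc m) g" for m g
  proof -
    have g: "g \<in> carrier G" "word_length G S g = Suc m"
      "\<And>n. n \<in> N \<Longrightarrow> Suc m \<le> word_length G S (n \<otimes> g)" using Q by (auto simp: Q_def)
    obtain x h where x: "x \<in> S \<union> m_inv G ` S" "h \<in> carrier G" "g = x \<otimes> h"
      "word_length G S h \<le> m"
      using word_length_Suc_split[OF S g(1,2)] .
    then have xc: "x \<in> carrier G" using S by auto
    have min: "m \<le> word_length G S (n \<otimes> h)" if n: "n \<in> N" for n
    proof -
      have nc: "n \<in> carrier G" using n by simp
      \<comment> \<open>Conjugation carries \<open>n\<close> past the first letter of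
        \<open>g\<close> and stays in \<open>N\<close>, so a representative of the coset of
        \<open>h\<close> shorter than \<open>m\<close> would shorten that of
        \<open>g\<close>.\<close>
      have "(x \<otimes> n \<otimes> inv x) \<otimes> g = x \<otimes> (n \<otimes> h)"
        using x xc nc by (simp add: m_assoc inv_solve_left')
      then have "Suc m \<le> word_length G S (x \<otimes> (n \<otimes> h))"
        using g(3)[OF N.inv_op_closed2[OF xc n]] by simp
      also have "\<dots> \<le> Suc (word_length G S (n \<otimes> h))"
        using x nc by (intro word_length_Cons_le[OF S]) auto
      finally show ?thesis by simp
    qed
    have "word_length G S h = m" using min[OF N.one_closed] x by simp
    then show ?thesis using x min unfolding Q_def by blast
  qed
  obtain g where g: "g \<in> carrier G" "\<And>n. n \<in> N \<Longrightarrow> k < word_length G S (n \<otimes> g)"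
    using unbounded by blast
  \<comment> \<open>The shortest element of a far coset has length above \<open>k\<close>; removing
    letters one by one with \<open>step\<close> then reaches length exactly
    \<open>k\<close>.\<close>
  define n where "n = arg_min (\<lambda>n. word_length G S (n \<otimes> g)) (\<lambda>n. n \<in> N)"
  have n: "n \<in> N" "\<And>m. m \<in> N \<Longrightarrow> word_length G S (n \<otimes> g) \<le> word_length G S (m \<otimes> g)"
    using arg_min_nat_lemma[of "\<lambda>n. n \<in> N" \<one> "\<lambda>n. word_length G S (n \<otimes> g)"] N.one_closed
    by (auto simp: n_def)
  have "Q (word_length G S (n \<otimes> g)) (n \<otimes> g)"
    unfolding Q_def using n g by (auto simp flip: m_assoc)
  moreover have "k \<le> word_length G S (n \<otimes> g)" using g n by (simp add: less_imp_le)
  ultimately have "\<exists>h. Q k h"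
    using inc_induct[of k "word_length G S (n \<otimes> g)" "\<lambda>k. \<exists>h. Q k h"] step by blast
  then show thesis using that by (auto simp: Q_def)
qed

end

section \<open>Compact sets and word length\<close>

context topological_group
begin

text \<open>By induction, the set is the image under multiplication of a product of compact sets.
  Adding \<open>\<one>\<close> to the letters accounts for shorter words.\<close>

lemma compactin_words:
  assumes S: "compactin X S"
  shows "compactin X {foldr (mult G) xs \<one> | xs. length xs \<le> n \<and> set xs \<subseteq> S \<union> m_inv G ` S}"
    (is "compactin X (?W n)")
proof (induction n)
  case 0
  have "?W 0 = {\<one>}" by auto
  then show ?case using topspace_eq by (simp add: finite_imp_compactin)
next
  case (Suc n)
  define V where "V = {\<one>} \<union> (S \<union> m_inv G ` S)"
  have Sc: "S \<subseteq> carrier G" using compactin_subset_topspace[OF S] topspace_eq by simp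
  have V: "compactin X V"
    unfolding V_def
  proof (intro compactin_Un)
    show "compactin X {\<one>}" using topspace_eq by (intro finite_imp_compactin) simp_all
    show "compactin X (m_inv G ` S)" using image_compactin[OF S continuous_inv] .
  qed (fact S)
  have "?W (Suc n) = (\<lambda>(x, y). x \<otimes> y) ` (V \<times> ?W n)"
  proof
    show "?W (Suc n) \<subseteq> (\<lambda>(x, y). x \<otimes> y) ` (V \<times> ?W n)"
    proof
      fix g assume "g \<in> ?W (Suc n)"
      then obtain xs where xs: "length xs \<le> Suc n" "set xs \<subseteq> S \<union> m_inv G ` S"
        "g = foldr (mult G) xs \<one>" by blast
      show "g \<in> (\<lambda>(x, y). x \<otimes> y) ` (V \<times> ?W n)"
      proof (cases xs)
        case Nil
        then show ?thesis using xs
          by (intro image_eqI[of _ _ "(\<one>, \<one>)"]) (auto simp: V_def intro!: exI[of _ "[]"])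
      next
        case (Cons x ys)
        then show ?thesis using xs
          by (intro image_eqI[of _ _ "(x, foldr (mult G) ys \<one>)"]) (auto simp: V_def)
      qed
    qed
    have "x \<otimes> foldr (mult G) ys \<one> \<in> ?W (Suc n)"
      if "x \<in> V" "length ys \<le> n" "set ys \<subseteq> S \<union> m_inv G ` S" for x ys
    proof (cases "x = \<one>")
      case True
      have "set ys \<subseteq> carrier G" using that Sc by auto
      then have "foldr (mult G) ys \<one> \<in> carrier G" using foldr_mult by blast
      then show ?thesis using True that by (auto intro!: exI[of _ ys])
    next
      case False
      then show ?thesis using that by (auto simp: V_def intro!: exI[of _ "x # ys"])
    qed
    then show "(\<lambda>(x, y). x \<otimes> y) ` (V \<times> ?W n) \<subseteq> ?W (Suc n)" by auto
  qed
  then show ?case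
    using image_compactin[OF compactin_Times[THEN iffD2] continuous_mult, of V "?W n"] V Suc by simp
qed

lemma compact_generating_setD:
  assumes "compact_generating_set G X S"
  shows "S \<subseteq> carrier G" "generate G S = carrier G" "compactin X S"
  using assms compactin_subset_topspace[of X S] topspace_eq
  by (auto simp: compact_generating_set_def)

lemma compactin_word_ball:
  assumes "compact_generating_set G X S"
  shows "compactin X {g \<in> carrier G. word_length G S g \<le> n}"
proof -
  note S = compact_generating_setD[OF assms]
  have "{g \<in> carrier G. word_length G S g \<le> n} =
    {foldr (mult G) xs \<one> | xs. length xs \<le> n \<and> set xs \<subseteq> S \<union> m_inv G ` S}"
  proof (intro equalityI subsetI)
    fix g assume g: "g \<in> {g \<in> carrier G. word_length G S g \<le> n}"
    then obtain xs where "length xs = word_length G S g" "set xs \<subseteq> S \<union> m_inv G ` S"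
      "foldr (mult G) xs \<one> = g"
      using word_length_word[OF S(1,2), of g] by blast
    then show "g \<in> {foldr (mult G) xs \<one> | xs. length xs \<le> n \<and> set xs \<subseteq> S \<union> m_inv G ` S}"
      using g by auto
  next
    fix g assume "g \<in> {foldr (mult G) xs \<one> | xs. length xs \<le> n \<and> set xs \<subseteq> S \<union> m_inv G ` S}"
    then obtain xs where xs: "length xs \<le> n" "set xs \<subseteq> S \<union> m_inv G ` S"
      "g = foldr (mult G) xs \<one>" by blast
    then have "set xs \<subseteq> carrier G" using S by auto
    then show "g \<in> {g \<in> carrier G. word_length G S g \<le> n}"
      using xs foldr_mult[of xs \<one>] word_length_le[OF xs(2), of g] by auto
  qed
  then show ?thesis using compactin_words[OF S(3)] by simp
qed

lemma continuous_mult_left: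
  assumes "a \<in> carrier G" shows "continuous_map X X (\<lambda>x. a \<otimes> x)"
proof -
  have "continuous_map X (prod_topology X X) (\<lambda>x. (a, x))"
    using assms topspace_eq by (simp add: continuous_map_pairedI)
  from continuous_map_compose[OF this continuous_mult] show ?thesis by (simp add: comp_def)
qed

text \<open>By the Baire category theorem some ball of the word metric has interior; translates of that
  interior cover the compact set.\<close>

lemma word_length_bounded_on_compact:
  assumes X: "locally_compact_space X" "Hausdorff_space X"
    and gen: "compact_generating_set G X S" and K: "compactin X K"
  shows "\<exists>k. \<forall>x\<in>K. word_length G S x \<le> k"
proof -
  note S = compact_generating_setD[OF gen]
  define W where "W n = {g \<in> carrier G. word_length G S g \<le> n}" for n
  have "regular_space X"
    using X locally_compact_Hausdorff_imp_regular_space by blast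
  moreover have "closedin X (W n)" for n
    using compactin_imp_closedin[OF X(2) compactin_word_ball[OF gen]] by (simp add: W_def)
  moreover have "X interior_of \<Union>(range W) \<noteq> {}"
  proof -
    have "\<Union>(range W) = topspace X" by (auto simp: W_def topspace_eq)
    moreover have "X interior_of topspace X = topspace X" by (rule interior_of_topspace)
    ultimately show ?thesis using topspace_eq one_closed by auto
  qed
  ultimately obtain m where "X interior_of W m \<noteq> {}"
    using Baire_category_alt[of X "range W"] X by auto
  then obtain u where u: "u \<in> X interior_of W m" by blast
  define O' where "O' = X interior_of W m"
  have O': "openin X O'" "O' \<subseteq> W m" by (auto simp: O'_def interior_of_subset)
  have uc: "u \<in> carrier G" using O' u by (auto simp: O'_def W_def)
  \<comment> \<open>Left translation by \<open>u \<otimes> inv x\<close> sends \<open>x\<close> to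
    \<open>u\<close>, so this is an open neighbourhood of \<open>x\<close>; undoing the translation
    changes the length by a bounded amount.\<close>
  define U where "U x = {y \<in> topspace X. (u \<otimes> inv x) \<otimes> y \<in> O'}" for x
  show ?thesis
  proof (rule locally_bounded_imp_bounded_on_compact[OF K, of U])
    fix x assume "x \<in> K"
    then have x: "x \<in> carrier G" using compactin_subset_topspace[OF K] topspace_eq by auto
    have "openin X (U x)"
      unfolding U_def using openin_continuous_map_preimage[OF continuous_mult_left O'(1)] x uc by simp
    moreover have "(u \<otimes> inv x) \<otimes> x = u" using x uc by (simp add: m_assoc)
    ultimately show "openin X (U x) \<and> x \<in> U x"
      using x u topspace_eq by (simp add: U_def O'_def)
    show "\<exists>k. \<forall>y\<in>U x. word_length G S y \<le> k"
    proof (intro exI ballI)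
      fix y assume y: "y \<in> U x"
      define v where "v = (u \<otimes> inv x) \<otimes> y"
      have yc: "y \<in> carrier G" using y topspace_eq by (auto simp: U_def)
      have v: "v \<in> carrier G" "word_length G S v \<le> m"
        using y O' by (auto simp: U_def v_def W_def)
      have "y = inv (u \<otimes> inv x) \<otimes> v"
        using x uc yc by (simp add: v_def inv_solve_left)
      then have "word_length G S y \<le> word_length G S (inv (u \<otimes> inv x)) + word_length G S v"
        using word_length_mult_le[OF S(1,2), of "inv (u \<otimes> inv x)" v] x uc v by simp
      then show "word_length G S y \<le> word_length G S (inv (u \<otimes> inv x)) + m" using v by simp
    qed
  qed
qed

text \<open>A compact word ball meeting every coset maps onto the quotient.\<close>

lemma cocompact_subgroupI:
  assumes gen: "compact_generating_set G X S" and N: "subgroup N G"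
    and k: "\<And>g. g \<in> carrier G \<Longrightarrow> \<exists>n\<in>N. word_length G S (n \<otimes> g) \<le> k"
  shows "cocompact_subgroup G X N"
proof -
  let ?W = "{g \<in> carrier G. word_length G S g \<le> k}"
  note q = quotient_map_coset_topology[of N]
  have "topspace (coset_topology G X N) = (\<lambda>x. N #> x) ` topspace X"
    using quotient_imp_surjective_map[OF q] by simp
  also have "\<dots> = (\<lambda>x. N #> x) ` ?W"
  proof
    show "(\<lambda>x. N #> x) ` topspace X \<subseteq> (\<lambda>x. N #> x) ` ?W"
    proof clarify
      fix g assume "g \<in> topspace X"
      then have g: "g \<in> carrier G" using topspace_eq by simp
      obtain n where n: "n \<in> N" "word_length G S (n \<otimes> g) \<le> k" using k[OF g] by blast
      have nc: "n \<in> carrier G" using n N subgroup.mem_carrier by metis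
      have "N #> (n \<otimes> g) = N #> g"
        using coset_mult_assoc[of N n g] coset_join2[OF nc N n(1)] N nc g subgroup.subset by metis
      then show "N #> g \<in> (\<lambda>x. N #> x) ` ?W"
        using n nc g by (metis (mono_tags, lifting) imageI m_closed mem_Collect_eq)
    qed
  qed (auto simp: topspace_eq)
  finally show ?thesis
    unfolding cocompact_subgroup_def compact_space_def
    using image_compactin[OF compactin_word_ball[OF gen] quotient_imp_continuous_map[OF q]] by metis
qed

text \<open>Bounded length exhibits \<open>N\<close> as the set of words of length at most
  \<open>k\<close> in the compact set \<open>T\<close>.\<close>

lemma compactin_bounded_subgroup:
  assumes N: "subgroup N G"
    and gen: "compact_generating_set (G\<lparr>carrier := N\<rparr>) (subtopology X N) T"
    and k: "\<And>n. n \<in> N \<Longrightarrow> word_length (G\<lparr>carrier := N\<rparr>) T n \<le> k"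
  shows "compactin X N"
proof -
  interpret H: group "G\<lparr>carrier := N\<rparr>" using N subgroup.subgroup_is_group by blast
  have T: "compactin X T" "T \<subseteq> N" "generate (G\<lparr>carrier := N\<rparr>) T = N"
    using gen by (auto simp: compact_generating_set_def compactin_subtopology)
  note inv = subgroup_inv_image[OF N T(2)]
  have "{foldr (mult G) xs \<one> | xs. length xs \<le> k \<and> set xs \<subseteq> T \<union> m_inv G ` T} = N" (is "?W = N")
  proof
    show "N \<subseteq> ?W"
    proof
      fix n assume n: "n \<in> N"
      obtain xs where "length xs = word_length (G\<lparr>carrier := N\<rparr>) T n"
        "set xs \<subseteq> T \<union> m_inv G ` T" "foldr (mult G) xs \<one> = n"
        using H.word_length_word[of T n] T n inv by auto
      then show "n \<in> ?W" using k[OF n] by auto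
    qed
    show "?W \<subseteq> N"
    proof clarify
      fix xs assume "set xs \<subseteq> T \<union> m_inv G ` T"
      then have "set xs \<subseteq> N" using T(2) N by (auto dest: subgroup.m_inv_closed)
      then show "foldr (mult G) xs \<one> \<in> N"
        using H.foldr_mult[of xs \<one>] H.one_closed by simp
    qed
  qed
  then show ?thesis using compactin_words[OF T(1), of k] by simp
qed

text \<open>The letters in \<open>T\<close> form a compact set, so their \<open>S\<close>-lengths
  are bounded by some \<open>k\<close>; a word pays at most \<open>k\<close> per letter.\<close>

lemma word_length_le_mult_word_length:
  assumes X: "locally_compact_space X" "Hausdorff_space X"
    and S: "compact_generating_set G X S" and N: "subgroup N G"
    and T: "compact_generating_set (G\<lparr>carrier := N\<rparr>) (subtopology X N) T"
  shows "\<exists>k. \<forall>n\<in>N. word_length G S n \<le> k * word_length (G\<lparr>carrier := N\<rparr>) T n"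
proof -
  interpret H: group "G\<lparr>carrier := N\<rparr>" using N subgroup.subgroup_is_group by blast
  have T': "compactin X T" "T \<subseteq> N" "generate (G\<lparr>carrier := N\<rparr>) T = N"
    using T by (auto simp: compact_generating_set_def compactin_subtopology)
  obtain k where k: "\<And>x. x \<in> T \<Longrightarrow> word_length G S x \<le> k"
    using word_length_bounded_on_compact[OF X S T'(1)] by blast
  have "word_length G S n \<le> k * word_length (G\<lparr>carrier := N\<rparr>) T n" if n: "n \<in> N" for n
  proof -
    obtain xs where xs: "length xs = word_length (G\<lparr>carrier := N\<rparr>) T n"
      "set xs \<subseteq> T \<union> m_inv G ` T" "foldr (mult G) xs \<one> = n"
      using H.word_length_word[of T n] T' n subgroup_inv_image[OF N T'(2)] by auto
    have "T \<subseteq> carrier G" using T'(2) N subgroup.subset by blast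
    then show ?thesis
      using word_length_foldr_le[OF compact_generating_setD(1,2)[OF S] _ k xs(2)] xs by simp
  qed
  then show ?thesis by blast
qed

text \<open>The generating set of \<open>G\<close> in the hypothesis may differ from
  \<open>S\<close>, so the two are compared first. The additive constant disappears because word
  lengths are integers.\<close>

lemma quasi_isometrically_embedded_bilipschitz:
  assumes X: "locally_compact_space X" "Hausdorff_space X"
    and S: "compact_generating_set G X S" and N: "subgroup N G"
    and qi: "quasi_isometrically_embedded_subgroup G X N"
  obtains T k where "compact_generating_set (G\<lparr>carrier := N\<rparr>) (subtopology X N) T" "k > 0"
    "\<And>n. n \<in> N \<Longrightarrow> word_length G S n \<le> k * word_length (G\<lparr>carrier := N\<rparr>) T n"
    "\<And>n. n \<in> N \<Longrightarrow> word_length (G\<lparr>carrier := N\<rparr>) T n \<le> k * word_length G S n"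
proof -
  let ?H = "G\<lparr>carrier := N\<rparr>"
  interpret H: group ?H using N subgroup.subgroup_is_group by blast
  obtain S' T where S': "compact_generating_set G X S'"
    and T: "compact_generating_set ?H (subtopology X N) T"
    and emb: "quasi_isometric_embedding N (word_metric ?H T) (carrier G) (word_metric G S') (\<lambda>x. x)"
    using qi unfolding quasi_isometrically_embedded_subgroup_def by blast
  obtain L C where LC: "L \<ge> 1" "C \<ge> 0"
    "\<And>x y. x \<in> N \<Longrightarrow> y \<in> N \<Longrightarrow> word_metric ?H T x y / L - C \<le> word_metric G S' x y"
    using emb unfolding quasi_isometric_embedding_def by blast
  obtain p where p: "\<And>n. n \<in> N \<Longrightarrow> word_length G S n \<le> p * word_length ?H T n"
    using word_length_le_mult_word_length[OF X S N T] by blast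
  \<comment> \<open>Viewing \<open>G\<close> as a subgroup of itself compares its two generating
    sets.\<close>
  have "compact_generating_set (G\<lparr>carrier := carrier G\<rparr>) (subtopology X (carrier G)) S"
    using S subtopology_topspace[of X] topspace_eq by simp
  then obtain q where q: "\<And>g. g \<in> carrier G \<Longrightarrow> word_length G S' g \<le> q * word_length G S g"
    using word_length_le_mult_word_length[OF X S' subgroup_self, of S] by auto
  define r where "r = nat \<lceil>L * (q + C)\<rceil>"
  have r: "word_length ?H T n \<le> r * word_length G S n" if n: "n \<in> N" for n
  proof (cases "word_length G S n = 0")
    case True
    have nc: "n \<in> carrier G" using n N subgroup.mem_carrier by metis
    have "n = \<one>"
      using word_length_word[OF compact_generating_setD(1,2)[OF S] nc] True by auto
    then show ?thesis using H.word_length_one[of T] by simp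
  next
    case False
    have nc: "n \<in> carrier G" using n N subgroup.mem_carrier by metis
    have one: "\<one> \<in> N" using N subgroup.one_closed by metis
    have "inv\<^bsub>?H\<^esub> \<one> = \<one>" using m_inv_consistent[OF N one] by simp
    then have "word_length ?H T n / L - C \<le> word_length G S' n"
      using LC(3)[OF one n] nc by (simp add: word_metric_def)
    also have "\<dots> \<le> real (q * word_length G S n)"
      using q[OF nc] by (simp only: of_nat_le_iff)
    finally have "word_length ?H T n \<le> L * (q * word_length G S n + C)"
      using LC(1) by (simp add: field_simps)
    \<comment> \<open>Here \<open>n\<close> has length at least 1, which absorbs
      \<open>C\<close>.\<close>
    also have "\<dots> \<le> L * (q * word_length G S n + C * word_length G S n)"
      using LC False by (intro mult_left_mono add_left_mono) (auto simp: mult_le_cancel_left1)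
    also have "\<dots> = L * (q + C) * word_length G S n" by (simp add: algebra_simps)
    also have "\<dots> \<le> real r * word_length G S n"
      unfolding r_def by (intro mult_right_mono real_nat_ceiling_ge) simp
    finally show ?thesis by (simp only: of_nat_le_iff flip: of_nat_mult)
  qed
  show thesis
  proof (rule that[OF T, of "p + r + 1"])
    fix n assume n: "n \<in> N"
    have "p * word_length ?H T n \<le> (p + r + 1) * word_length ?H T n" by (intro mult_right_mono) auto
    then show "word_length G S n \<le> (p + r + 1) * word_length ?H T n" using p[OF n] by linarith
    have "r * word_length G S n \<le> (p + r + 1) * word_length G S n" by (intro mult_right_mono) auto
    then show "word_length ?H T n \<le> (p + r + 1) * word_length G S n" using r[OF n] by linarith
  qed simp
qed

end

section \<open>Normal subgroups and the asymptotic cone\<close>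

text \<open>The prefixes of a shortest word form a discrete geodesic, two of them differing by the
  subword in between. As \<open>take\<close> is constant past the end, \<open>p\<close> is defined
  for all indices.\<close>

lemma (in group) geodesic_word_prefixes:
  assumes "S \<subseteq> carrier G" "generate G S = carrier G" "g \<in> carrier G"
  obtains p where "p 0 = \<one>" "p (word_length G S g) = g" "\<And>i. p i \<in> carrier G"
    "\<And>i j. i \<le> j \<Longrightarrow> word_length G S (inv (p i) \<otimes> p j) \<le> j - i"
proof -
  obtain xs where xs: "length xs = word_length G S g" "set xs \<subseteq> S \<union> m_inv G ` S"
    "foldr (mult G) xs \<one> = g" using word_length_word[OF assms] .
  define p where "p i = foldr (mult G) (take i xs) \<one>" for i
  have sub: "set ys \<subseteq> carrier G" if "set ys \<subseteq> set xs" for ys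
    using that xs(2) assms(1) by auto
  have pc: "p i \<in> carrier G" for i
    using foldr_mult[OF sub[OF set_take_subset] one_closed] by (simp add: p_def)
  have "word_length G S (inv (p i) \<otimes> p j) \<le> j - i" if "i \<le> j" for i j
  proof -
    define ys where "ys = drop i (take j xs)"
    have ys: "set ys \<subseteq> set xs" by (auto simp: ys_def dest: in_set_dropD in_set_takeD)
    have yc: "foldr (mult G) ys \<one> \<in> carrier G" using foldr_mult[OF sub[OF ys] one_closed] by simp
    have "take j xs = take i xs @ ys"
      using that by (metis append_take_drop_id min.absorb1 take_take ys_def)
    then have "p j = p i \<otimes> foldr (mult G) ys \<one>"
      using foldr_mult[OF sub[OF set_take_subset] yc, of i] by (simp add: p_def)
    then have "inv (p i) \<otimes> p j = foldr (mult G) ys \<one>"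
      using pc yc by (simp flip: m_assoc)
    then have "word_length G S (inv (p i) \<otimes> p j) \<le> length ys"
      using ys xs(2) by (intro word_length_le) auto
    also have "\<dots> \<le> j - i" by (simp add: ys_def)
    finally show ?thesis .
  qed
  then show thesis using that[of p] pc xs by (simp add: p_def)
qed

text \<open>An ultrafilter containing a singleton is principal, so this one contains all cofinite
  sets.\<close>

lemma nonprincipal_ultrafilter_le_sequentially:
  assumes "nonprincipal_ultrafilter \<omega>" shows "\<omega> \<le> sequentially"
proof -
  have nb: "\<omega> \<noteq> bot" and np: "\<And>n. \<omega> \<noteq> principal {n}"
    and ultra: "\<And>P. eventually P \<omega> \<or> eventually (\<lambda>n. \<not> P n) \<omega>"
    using assms by (auto simp: nonprincipal_ultrafilter_def)
  have ne: "eventually (\<lambda>m. m \<noteq> n) \<omega>" for n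
  proof (rule ccontr)
    assume "\<not> ?thesis"
    then have n: "eventually (\<lambda>m. m = n) \<omega>" using ultra[of "\<lambda>m. m = n"] by auto
    have "eventually P \<omega> \<longleftrightarrow> P n" for P
    proof
      assume "eventually P \<omega>"
      with n have "eventually (\<lambda>m. P n) \<omega>" by eventually_elim simp
      then show "P n" using nb by simp
    next
      assume "P n"
      then show "eventually P \<omega>" using n by (auto elim: eventually_mono)
    qed
    then have "\<omega> = principal {n}" by (simp add: filter_eq_iff eventually_principal)
    then show False using np by blast
  qed
  have "eventually (\<lambda>m. n \<le> m) \<omega>" for n
  proof -
    have "eventually (\<lambda>m. \<forall>i\<in>{..<n}. m \<noteq> i) \<omega>"
      using ne by (intro eventually_ball_finite) auto
    then show ?thesis by (rule eventually_mono) (metis lessThan_iff not_le_imp_less)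
  qed
  then show ?thesis
    unfolding le_filter_def eventually_sequentially by (blast intro: eventually_mono)
qed

section \<open>The precone as a group with a left-invariant pseudometric\<close>

context asymptotic_cone_data
begin

lemma eventually_s_ge: "eventually (\<lambda>n. c \<le> s n) \<omega>"
proof -
  have "filterlim s at_top \<omega>"
    using s filterlim_mono[OF _ order_refl nonprincipal_ultrafilter_le_sequentially[OF \<omega>]]
    by (auto simp: scaling_sequence_def)
  then show ?thesis by (simp add: filterlim_at_top)
qed

lemma preconeI:
  assumes "\<And>n. g n \<in> carrier G" "\<And>n. real (word_length G S (g n)) \<le> C * s n"
  shows "g \<in> P"
proof -
  \<comment> \<open>The constant in \<open>precone\<close> has to be positive.\<close>
  have "real (word_length G S (g n)) \<le> max C 1 * s n" for n
    using assms(2)[of n] mult_right_mono[of C "max C 1" "s n"] s_pos[of n] by linarith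
  then show ?thesis using assms(1) unfolding precone_def
    by (auto intro!: exI[of _ "max C 1"])
qed

lemma preconeD:
  assumes "g \<in> P"
  obtains C where "C > 0" "\<And>n. real (word_length G S (g n)) \<le> C * s n"
  using assms unfolding precone_def by auto

lemma one_in_precone: "(\<lambda>_. \<one>) \<in> P"
  by (rule preconeI[of _ 0]) auto

lemma mult_in_precone:
  assumes "g \<in> P" "h \<in> P" shows "(\<lambda>n. g n \<otimes> h n) \<in> P"
proof -
  obtain C C' where C: "\<And>n. real (word_length G S (g n)) \<le> C * s n"
    "\<And>n. real (word_length G S (h n)) \<le> C' * s n" using assms preconeD by metis
  show ?thesis
  proof (rule preconeI[of _ "C + C'"])
    fix n
    have "word_length G S (g n \<otimes> h n) \<le> word_length G S (g n) + word_length G S (h n)"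
      using assms P_carrier by (intro word_length_mult_le S)
    then show "real (word_length G S (g n \<otimes> h n)) \<le> (C + C') * s n"
      using C(1)[of n] C(2)[of n] by (simp add: algebra_simps)
  qed (use assms P_carrier in simp)
qed

lemma inv_in_precone:
  assumes "g \<in> P" shows "(\<lambda>n. inv (g n)) \<in> P"
proof -
  obtain C where "\<And>n. real (word_length G S (g n)) \<le> C * s n" using assms preconeD by metis
  then show ?thesis
    using assms P_carrier word_length_inv[OF S] by (intro preconeI[of _ C]) auto
qed

lemma D_left_mult:
  assumes "u \<in> P" "g \<in> P" "h \<in> P"
  shows "D (\<lambda>n. u n \<otimes> g n) (\<lambda>n. u n \<otimes> h n) = D g h"
proof -
  have "inv (u n \<otimes> g n) \<otimes> (u n \<otimes> h n) = inv (g n) \<otimes> h n" for n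
    using P_carrier[OF assms(1)] P_carrier[OF assms(2)] P_carrier[OF assms(3)]
    by (simp add: inv_mult_group m_assoc inv_solve_left')
  then show ?thesis by (simp add: precone_dist_def word_metric_def)
qed

lemma D_one_lower_bound:
  assumes "g \<in> P" "eventually (\<lambda>n. r * s n \<le> word_length G S (g n)) \<omega>"
  shows "r \<le> D (\<lambda>_. \<one>) g"
proof (rule tendsto_lowerbound[OF precone_dist_tendsto[OF one_in_precone assms(1)] _ \<omega>_nontrivial])
  show "eventually (\<lambda>n. r \<le> word_metric G S \<one> (g n) / s n) \<omega>"
    using assms(2) by eventually_elim
      (simp add: word_metric_def P_carrier[OF assms(1)] s_pos pos_le_divide_eq)
qed

text \<open>Evaluated on classes, the inequality passes from the cone to the pseudometric on
  sequences.\<close>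

lemma D_four_point:
  assumes "real_tree (asymptotic_cone G S s \<omega>) (cone_dist G S s \<omega>)"
    and "x \<in> P" "y \<in> P" "z \<in> P" "w \<in> P"
  shows "D x w + D y z \<le> max (D x z + D y w) (D x y + D w z)"
proof -
  have "R `` {v} \<in> asymptotic_cone G S s \<omega>" if "v \<in> P" for v
    using that by (simp add: asymptotic_cone_eq quotientI)
  then show ?thesis
    using Metric_space.real_tree_four_point[OF Metric_space_asymptotic_cone assms(1),
        of "R `` {x}" "R `` {y}" "R `` {z}" "R `` {w}"] assms(2-5)
    by (simp add: cone_dist_classes)
qed

text \<open>In terms of Gromov products based at \<open>x\<close>, the four-point condition says that the product of
  the endpoints of a chain is at least the minimum over its steps, and each step contributes at
  least \<open>\<rho> - \<epsilon> / 2\<close>.\<close>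

lemma chain_distance:
  assumes tree: "real_tree (asymptotic_cone G S s \<omega>) (cone_dist G S s \<omega>)"
    and c: "\<And>i. c i \<in> P" and x: "x \<in> P" and far: "\<And>i. \<rho> \<le> D (c i) x"
    and step: "\<And>i. D (c i) (c (Suc i)) \<le> \<epsilon>"
  shows "2 * \<rho> - \<epsilon> \<le> D (c 0) x + D (c m) x - D (c 0) (c m)"
proof (induction m)
  case 0
  have "0 \<le> \<epsilon>" using D_nonneg[OF c c, of 0 1] step[of 0] by simp
  then show ?case using far[of 0] D_self[OF c] by simp
next
  case (Suc m)
  \<comment> \<open>If the first term is the maximum, \<open>far\<close> and \<open>step\<close>
    conclude; if the second is, the induction hypothesis does.\<close>
  have "D (c 0) (c (Suc m)) + D (c m) x
      \<le> max (D (c 0) x + D (c m) (c (Suc m))) (D (c 0) (c m) + D (c (Suc m)) x)"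
    by (rule D_four_point[OF tree c c x c])
  then show ?case using Suc far[of m] far[of "Suc m"] step[of m] by (auto simp: max_def split: if_splits)
qed

end

section \<open>Orbits of an undistorted normal subgroup\<close>

locale bilipschitz_normal_subgroup = asymptotic_cone_data G S s \<omega> + N: normal N G
  for G :: "('a, 'b) monoid_scheme" (structure) and S s \<omega> N +
  fixes T :: "'a set" and k :: nat
  assumes T: "T \<subseteq> N" "generate (G\<lparr>carrier := N\<rparr>) T = N"
    and length_le: "\<And>n. n \<in> N \<Longrightarrow> word_length G S n \<le> k * word_length (G\<lparr>carrier := N\<rparr>) T n"
    and length_ge: "\<And>n. n \<in> N \<Longrightarrow> word_length (G\<lparr>carrier := N\<rparr>) T n \<le> k * word_length G S n"
begin

abbreviation "H \<equiv> G\<lparr>carrier := N\<rparr>"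

text \<open>As \<open>S\<close>-length and \<open>T\<close>-length are comparable on
  \<open>N\<close>, this is the precone of \<open>N\<close> itself.\<close>

definition "P\<^sub>N = {a \<in> P. \<forall>i. a i \<in> N}"

text \<open>This is the connectedness of the orbit of the base point. A shortest
  \<open>T\<close>-word for each \<open>a j\<close> is cut into \<open>m\<close> nearly equal
  pieces, with \<open>m\<close> independent of \<open>j\<close> because the lengths are
  \<open>O(s j)\<close>.\<close>

lemma precone_chain:
  assumes a: "a \<in> P\<^sub>N" and \<epsilon>: "\<epsilon> > 0"
  obtains c m where "c 0 = (\<lambda>_. \<one>)" "c m = a" "\<And>i. c i \<in> P\<^sub>N" "\<And>i. D (c i) (c (Suc i)) \<le> \<epsilon>"
proof -
  interpret H: group H using N.subgroup_is_group is_group .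
  define l where "l j = word_length H T (a j)" for j
  have aP: "a \<in> P" and aN: "a j \<in> N" for j using a by (auto simp: P\<^sub>N_def)
  obtain C where C: "C > 0" "\<And>j. real (word_length G S (a j)) \<le> C * s j"
    using aP preconeD by metis
  have l: "real (l j) \<le> k * C * s j" for j
  proof -
    have "real (l j) \<le> real (k * word_length G S (a j))"
      using length_ge[OF aN] by (simp only: of_nat_le_iff l_def)
    also have "\<dots> \<le> k * (C * s j)" unfolding of_nat_mult using C by (intro mult_left_mono) auto
    finally show ?thesis by (simp add: mult.assoc)
  qed
  have "\<exists>p. p 0 = \<one> \<and> p (l j) = a j \<and> (\<forall>i. p i \<in> N) \<and>
      (\<forall>i i'. i \<le> i' \<longrightarrow> word_length H T (inv (p i) \<otimes> p i') \<le> i' - i)" for j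
  proof -
    have *: "T \<subseteq> carrier H" "generate H T = carrier H" "a j \<in> carrier H" using T aN by auto
    obtain p where p: "p 0 = \<one>\<^bsub>H\<^esub>" "p (word_length H T (a j)) = a j" "\<And>i. p i \<in> carrier H"
      "\<And>i i'. i \<le> i' \<Longrightarrow> word_length H T (inv\<^bsub>H\<^esub> (p i) \<otimes>\<^bsub>H\<^esub> p i') \<le> i' - i"
      using H.geodesic_word_prefixes[OF *] by blast
    have "inv\<^bsub>H\<^esub> (p i) = inv (p i)" for i
      using p(3)[of i] m_inv_consistent[OF N.subgroup_axioms] by simp
    then show ?thesis using p by (intro exI[of _ p]) (auto simp: l_def)
  qed
  then obtain p where p: "\<And>j. p j 0 = \<one>" "\<And>j. p j (l j) = a j" "\<And>j i. p j i \<in> N"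
    and p_step: "\<And>j i i'. i \<le> i' \<Longrightarrow> word_length H T (inv (p j i) \<otimes> p j i') \<le> i' - i" by metis
  have p_step_S: "word_length G S (inv (p j i) \<otimes> p j i') \<le> k * (i' - i)" if "i \<le> i'" for i i' j
  proof -
    have "inv (p j i) \<otimes> p j i' \<in> N" using p(3) by blast
    then have "word_length G S (inv (p j i) \<otimes> p j i')
        \<le> k * word_length H T (inv (p j i) \<otimes> p j i')" by (rule length_le)
    also have "\<dots> \<le> k * (i' - i)" using p_step[OF that] by (rule mult_left_mono) simp
    finally show ?thesis .
  qed
  \<comment> \<open>This choice keeps \<open>k * (k * C) / m\<close> below
    \<open>\<epsilon> / 2\<close>; the other half is reserved for rounding.\<close>
  obtain m :: nat where m: "2 * (k * (k * C)) / \<epsilon> < m" using reals_Archimedean2 by blast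
  have "0 \<le> 2 * (k * (k * C)) / \<epsilon>" using C \<epsilon> by simp
  then have m0: "m > 0" using m by (cases m) auto
  \<comment> \<open>The cut points are rounded down; the minimum keeps the chain constant at
    \<open>a\<close> from index \<open>m\<close> on.\<close>
  define t where "t i j = min (l j) (i * l j div m)" for i j
  \<comment> \<open>The two remainders sum to less than \<open>2 * m\<close>, so the carry is at
    most 1.\<close>
  have t_step: "t i j \<le> t (Suc i) j" "t (Suc i) j - t i j \<le> l j div m + 1" for i j
  proof -
    have "Suc i * l j div m = l j div m + i * l j div m + (l j mod m + i * l j mod m) div m"
      by (simp add: div_add1_eq[of "l j" "i * l j" m])
    moreover have "l j mod m + i * l j mod m < 2 * m"
      using m0 mod_less_divisor[of m "l j"] mod_less_divisor[of m "i * l j"] by linarith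
    then have "(l j mod m + i * l j mod m) div m < 2" using m0 by (simp add: less_mult_imp_div_less)
    ultimately show "t i j \<le> t (Suc i) j" "t (Suc i) j - t i j \<le> l j div m + 1"
      by (auto simp: t_def min_def)
  qed
  define c where "c i = (\<lambda>j. p j (t i j))" for i
  have cA: "c i \<in> P\<^sub>N" for i
  proof -
    have "c i \<in> P"
    proof (rule preconeI)
      fix j
      show "c i j \<in> carrier G" using p(3) N.mem_carrier by (simp add: c_def)
      have "word_length G S (c i j) \<le> k * t i j"
        using p_step_S[of 0 "t i j" j] p by (simp add: c_def)
      also have "\<dots> \<le> k * l j" by (intro mult_left_mono) (simp_all add: t_def)
      finally have "real (word_length G S (c i j)) \<le> real (k * l j)" by (simp only: of_nat_le_iff)
      also have "\<dots> \<le> k * (k * C * s j)" unfolding of_nat_mult using l by (intro mult_left_mono) auto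
      finally show "real (word_length G S (c i j)) \<le> (k * (k * C)) * s j" by (simp add: mult.assoc)
    qed
    then show ?thesis using p(3) by (simp add: P\<^sub>N_def c_def)
  qed
  show thesis
  proof (rule that)
    show "c 0 = (\<lambda>_. \<one>)" by (simp add: c_def t_def p)
    show "c m = a" using m0 by (simp add: c_def t_def p)
    show "c i \<in> P\<^sub>N" for i by (rule cA)
    have cP: "c i \<in> P" for i using cA by (simp add: P\<^sub>N_def)
    show "D (c i) (c (Suc i)) \<le> \<epsilon>" for i
    proof (rule tendsto_upperbound[OF precone_dist_tendsto[OF cP cP] _ \<omega>_nontrivial])
      show "eventually (\<lambda>j. word_metric G S (c i j) (c (Suc i) j) / s j \<le> \<epsilon>) \<omega>"
        \<comment> \<open>At this scale, one extra letter of \<open>T\<close>, costing at most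
          \<open>k\<close>, stays within \<open>\<epsilon> / 2 * s j\<close>.\<close>
        using eventually_s_ge[of "2 * k / \<epsilon>"]
      proof eventually_elim
        case (elim j)
        have "word_length G S (inv (c i j) \<otimes> c (Suc i) j) \<le> k * (t (Suc i) j - t i j)"
          unfolding c_def by (rule p_step_S[OF t_step(1)])
        also have "\<dots> \<le> k * (l j div m + 1)" using t_step(2) by (rule mult_left_mono) simp
        finally have "word_metric G S (c i j) (c (Suc i) j) \<le> real (k * (l j div m + 1))"
          unfolding word_metric_def by (simp only: of_nat_le_iff)
        also have "\<dots> = k * (real (l j div m) + 1)" by (simp add: distrib_left)
        also have "\<dots> \<le> k * (real (l j) / m + 1)"
          by (intro mult_left_mono add_right_mono of_nat_div_le_of_nat) simp
        also have "\<dots> \<le> k * (k * C * s j / m + 1)"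
          using l m0 by (intro mult_left_mono add_right_mono divide_right_mono) auto
        also have "\<dots> = (k * (k * C)) / m * s j + k" by (simp add: algebra_simps)
        also have "\<dots> \<le> \<epsilon> / 2 * s j + \<epsilon> / 2 * s j"
        proof (rule add_mono)
          have "(k * (k * C)) / m \<le> \<epsilon> / 2" using m m0 \<epsilon> by (simp add: field_simps)
          then show "(k * (k * C)) / m * s j \<le> \<epsilon> / 2 * s j"
            using s_pos[of j] by (intro mult_right_mono) auto
          show "real k \<le> \<epsilon> / 2 * s j" using elim \<epsilon> by (simp add: field_simps)
        qed
        finally show ?case using s_pos[of j] by (simp add: pos_divide_le_eq)
      qed
    qed
  qed
qed

text \<open>If \<open>u\<close> is a point of the orbit \<open>u P\<^sub>N\<close> nearest to \<open>x\<close>, then, since the orbit is connected, it is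
  the only one, and geodesics from the orbit to \<open>x\<close> pass through \<open>u\<close>.\<close>

lemma nearest_point_projection:
  assumes tree: "real_tree (asymptotic_cone G S s \<omega>) (cone_dist G S s \<omega>)"
    and u: "u \<in> P" and x: "x \<in> P" and a: "a \<in> P\<^sub>N"
    and near: "D u x = \<rho>" and far: "\<And>b. b \<in> P\<^sub>N \<Longrightarrow> \<rho> \<le> D (\<lambda>i. u i \<otimes> b i) x"
  shows "\<rho> + D (\<lambda>_. \<one>) a \<le> D (\<lambda>i. u i \<otimes> a i) x"
proof (rule field_le_epsilon)
  fix \<epsilon> :: real assume "\<epsilon> > 0"
  then obtain c m where c: "c 0 = (\<lambda>_. \<one>)" "c m = a" "\<And>i. c i \<in> P\<^sub>N"
    "\<And>i. D (c i) (c (Suc i)) \<le> \<epsilon>" using precone_chain[OF a] by metis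
  have cP: "c i \<in> P" for i using c by (simp add: P\<^sub>N_def)
  \<comment> \<open>Left translation by \<open>u\<close> moves the chain into
    \<open>u P\<^sub>N\<close> without changing its steps.\<close>
  define c' where "c' i = (\<lambda>j. u j \<otimes> c i j)" for i
  have dist: "D (c' i) (c' j) = D (c i) (c j)" for i j
    unfolding c'_def by (rule D_left_mult[OF u cP cP])
  have "2 * \<rho> - \<epsilon> \<le> D (c' 0) x + D (c' m) x - D (c' 0) (c' m)"
  proof (rule chain_distance[OF tree _ x])
    show "c' i \<in> P" for i unfolding c'_def by (rule mult_in_precone[OF u cP])
    show "\<rho> \<le> D (c' i) x" for i unfolding c'_def by (rule far[OF c(3)])
    show "D (c' i) (c' (Suc i)) \<le> \<epsilon>" for i using c(4) by (simp add: dist)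
  qed
  moreover have "c' 0 = u" using P_carrier[OF u] by (simp add: c'_def c)
  moreover have "c' m = (\<lambda>i. u i \<otimes> a i)" by (simp add: c'_def c)
  ultimately show "\<rho> + D (\<lambda>_. \<one>) a \<le> D (\<lambda>i. u i \<otimes> a i) x + \<epsilon>"
    using near dist[of 0 m] c by simp
qed

text \<open>With the base point \<open>e\<close> and \<open>\<rho> = D e g = D a (a g)\<close>, projecting \<open>g\<close> to \<open>P\<^sub>N\<close> and \<open>e\<close> to \<open>g P\<^sub>N\<close>
  gives \<open>D a g + D e (a g) \<ge> 2 \<rho> + D e a + D g (a g)\<close>, against the four-point inequality.\<close>

lemma normal_subgroup_cone_dichotomy:
  assumes tree: "real_tree (asymptotic_cone G S s \<omega>) (cone_dist G S s \<omega>)"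
    and g: "g \<in> P" and minimal: "\<And>i n. n \<in> N \<Longrightarrow> word_length G S (g i) \<le> word_length G S (n \<otimes> g i)"
    and a: "a \<in> P\<^sub>N"
  shows "D (\<lambda>_. \<one>) g \<le> 0 \<or> D (\<lambda>_. \<one>) a \<le> 0"
proof (rule ccontr)
  let ?e = "\<lambda>_. \<one>"
  assume "\<not> ?thesis"
  then have pos: "0 < D ?e g" "0 < D ?e a" by auto
  have aP: "a \<in> P" and aN: "\<And>i. a i \<in> N" using a by (auto simp: P\<^sub>N_def)
  have gc: "g i \<in> carrier G" for i using P_carrier[OF g] .
  define ag where "ag = (\<lambda>i. a i \<otimes> g i)"
  \<comment> \<open>The conjugate satisfies \<open>g a' = a g\<close> and lies in
    \<open>P\<^sub>N\<close> by normality, so \<open>ag\<close> belongs to both orbits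
    \<open>P\<^sub>N g\<close> and \<open>g P\<^sub>N\<close>.\<close>
  define a' where "a' = (\<lambda>i. inv (g i) \<otimes> a i \<otimes> g i)"
  have agP: "ag \<in> P" unfolding ag_def by (rule mult_in_precone[OF aP g])
  have a'A: "a' \<in> P\<^sub>N"
    using mult_in_precone[OF mult_in_precone[OF inv_in_precone[OF g] aP] g] N.inv_op_closed1[OF gc aN]
    by (simp add: P\<^sub>N_def a'_def)
  then have a'P: "a' \<in> P" by (simp add: P\<^sub>N_def)
  have ga': "(\<lambda>i. g i \<otimes> a' i) = ag"
    using gc N.mem_carrier[OF aN] by (auto simp: a'_def ag_def simp flip: m_assoc)
  \<comment> \<open>Termwise, \<open>inv (b i) \<otimes> h i\<close> lies in the coset of
    \<open>g i\<close>, where \<open>g i\<close> is shortest; the limit keeps this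
    inequality.\<close>
  have sep: "D ?e g \<le> D b h" if b: "b \<in> P\<^sub>N" and h: "h \<in> P" "\<And>i. \<exists>n\<in>N. h i = n \<otimes> g i" for b h
  proof (rule tendsto_le[OF \<omega>_nontrivial])
    have bP: "b \<in> P" and bN: "\<And>i. b i \<in> N" using b by (auto simp: P\<^sub>N_def)
    show "((\<lambda>i. word_metric G S (b i) (h i) / s i) \<longlongrightarrow> D b h) \<omega>"
      by (rule precone_dist_tendsto[OF bP h(1)])
    show "((\<lambda>i. word_metric G S \<one> (g i) / s i) \<longlongrightarrow> D ?e g) \<omega>"
      by (rule precone_dist_tendsto[OF one_in_precone g])
    have "word_metric G S \<one> (g i) \<le> word_metric G S (b i) (h i)" for i
    proof -
      obtain n where n: "n \<in> N" "h i = n \<otimes> g i" using h(2) by blast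
      have "inv (b i) \<otimes> h i = (inv (b i) \<otimes> n) \<otimes> g i"
        using n N.mem_carrier bN gc by (simp add: m_assoc)
      moreover have "inv (b i) \<otimes> n \<in> N" using n bN by blast
      ultimately show ?thesis using minimal gc by (simp add: word_metric_def)
    qed
    then show "eventually (\<lambda>i. word_metric G S \<one> (g i) / s i \<le> word_metric G S (b i) (h i) / s i) \<omega>"
      using s_pos by (intro always_eventually allI divide_right_mono) (auto intro: less_imp_le)
  qed
  have eA: "?e \<in> P\<^sub>N" using one_in_precone by (simp add: P\<^sub>N_def)
  have "D ?e g + D ?e a \<le> D (\<lambda>i. \<one> \<otimes> a i) g"
  proof (rule nearest_point_projection[OF tree one_in_precone g a refl])
    fix b assume b: "b \<in> P\<^sub>N"
    then have "(\<lambda>i. \<one> \<otimes> b i) = b" using P_carrier by (auto simp: P\<^sub>N_def)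
    moreover have "\<exists>n\<in>N. g i = n \<otimes> g i" for i using gc by (intro bexI[of _ \<one>]) auto
    ultimately show "D ?e g \<le> D (\<lambda>i. \<one> \<otimes> b i) g" using sep[OF b g] by simp
  qed
  then have 1: "D ?e g + D ?e a \<le> D a g" using P_carrier[OF aP] by simp
  have "D ?e g + D ?e a' \<le> D (\<lambda>i. g i \<otimes> a' i) ?e"
  proof (rule nearest_point_projection[OF tree g one_in_precone a'A])
    show "D g ?e = D ?e g" using D_commute[OF g one_in_precone] .
    fix b assume b: "b \<in> P\<^sub>N"
    then have bP: "b \<in> P" and bN: "\<And>i. b i \<in> N" by (auto simp: P\<^sub>N_def)
    \<comment> \<open>By normality the points of \<open>g P\<^sub>N\<close> lie in the cosets of
      \<open>g\<close>, so \<open>sep\<close> applies to them.\<close>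
    have "\<exists>n\<in>N. g i \<otimes> b i = n \<otimes> g i" for i
      using N.inv_op_closed2[OF gc bN, of i i] gc N.mem_carrier[OF bN]
      by (intro bexI[of _ "g i \<otimes> b i \<otimes> inv (g i)"]) (auto simp: m_assoc)
    then show "D ?e g \<le> D (\<lambda>i. g i \<otimes> b i) ?e"
      using sep[OF eA mult_in_precone[OF g bP]] D_commute[OF one_in_precone mult_in_precone[OF g bP]]
      by simp
  qed
  then have 2: "D ?e g + D ?e a' \<le> D ?e ag"
    using D_commute[OF one_in_precone agP] by (simp add: ga')
  have ge: "(\<lambda>i. g i \<otimes> \<one>) = g" and ae: "(\<lambda>i. a i \<otimes> \<one>) = a"
    using gc P_carrier[OF aP] by auto
  have "D g ag = D ?e a'"
    using D_left_mult[OF g one_in_precone a'P] by (simp add: ga' ge)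
  moreover have "D a ag = D ?e g"
    using D_left_mult[OF aP one_in_precone g] by (simp add: ag_def ae)
  \<comment> \<open>By \<open>1\<close> and \<open>2\<close> the left side is at least
    \<open>2 * D ?e g + D ?e a + D ?e a'\<close>. The terms on the right are
    \<open>2 * D ?e g\<close> and \<open>D ?e a + D ?e a'\<close>, both smaller by
    positivity.\<close>
  moreover have "D ?e ag + D a g \<le> max (D ?e g + D a ag) (D ?e a + D ag g)"
    by (rule D_four_point[OF tree one_in_precone aP g agP])
  ultimately show False
    using 1 2 pos D_nonneg[OF one_in_precone a'P] D_commute[OF agP g] by (simp add: max_def split: if_splits)
qed

end

section \<open>Long elements of \<open>N\<close> and of the quotient at every scale\<close>

theorem proposition6p1:
  fixes G :: "('a, 'b) monoid_scheme" and X :: "'a topology" and N :: "'a set"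
  assumes "locally_compact_group G X"
    and "lacunary_hyperbolic G X"
    and "N \<lhd> G"
    and "closedin X N"
    and "compactly_generated (G\<lparr>carrier := N\<rparr>) (subtopology X N)"
    and "quasi_isometrically_embedded_subgroup G X N"
  shows "compactin X N \<or> cocompact_subgroup G X N"
proof (rule ccontr)
  assume "\<not> ?thesis"
  then have noncompact: "\<not> compactin X N" and noncocompact: "\<not> cocompact_subgroup G X N" by auto
  let ?H = "G\<lparr>carrier := N\<rparr>"
  interpret topological_group G X using assms(1) by (simp add: locally_compact_group_def)
  interpret N: normal N G by fact
  interpret H: group ?H using N.subgroup_is_group is_group .
  have X: "locally_compact_space X" "Hausdorff_space X"
    using assms(1) by (simp_all add: locally_compact_group_def)
  obtain S s \<omega> where gen: "compact_generating_set G X S" and s: "scaling_sequence s"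
    and \<omega>: "nonprincipal_ultrafilter \<omega>"
    and tree: "real_tree (asymptotic_cone G S s \<omega>) (cone_dist G S s \<omega>)"
    using assms(2) by (auto simp: lacunary_hyperbolic_def)
  note S = compact_generating_setD[OF gen]
  obtain T k where genT: "compact_generating_set ?H (subtopology X N) T" and k: "k > 0"
    and len: "\<And>n. n \<in> N \<Longrightarrow> word_length G S n \<le> k * word_length ?H T n"
      "\<And>n. n \<in> N \<Longrightarrow> word_length ?H T n \<le> k * word_length G S n"
    using quasi_isometrically_embedded_bilipschitz[OF X gen N.subgroup_axioms assms(6)] by blast
  have T': "T \<subseteq> N" "generate ?H T = N"
    using genT by (auto simp: compact_generating_set_def compactin_subtopology)
  interpret bilipschitz_normal_subgroup G S s \<omega> N T k
    by unfold_locales (use S s \<omega> T' len in auto)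
  have "\<exists>g\<in>carrier G. \<forall>n\<in>N. l < word_length G S (n \<otimes>\<^bsub>G\<^esub> g)" for l
    using cocompact_subgroupI[OF gen N.subgroup_axioms, of l] noncocompact by (meson not_le)
  then have "\<exists>g. g \<in> carrier G \<and> word_length G S g = l \<and> (\<forall>n\<in>N. l \<le> word_length G S (n \<otimes>\<^bsub>G\<^esub> g))" for l
    using coset_minimal_element[OF S(1,2) assms(3)] by metis
  then obtain g where g: "\<And>l. g l \<in> carrier G" "\<And>l. word_length G S (g l) = l"
    "\<And>l n. n \<in> N \<Longrightarrow> l \<le> word_length G S (n \<otimes>\<^bsub>G\<^esub> g l)" by metis
  \<comment> \<open>For the trivial subgroup every element is minimal in its coset, so an unbounded
    group has elements of each length.\<close>
  have "\<exists>a. a \<in> N \<and> word_length ?H T a = l" for l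
  proof (rule H.coset_minimal_element[of T "{\<one>\<^bsub>?H\<^esub>}" l])
    show "{\<one>\<^bsub>?H\<^esub>} \<lhd> ?H" by (rule H.one_is_normal)
    fix l
    obtain a where a: "a \<in> N" "l < word_length ?H T a"
      using compactin_bounded_subgroup[OF N.subgroup_axioms genT, of l] noncompact
      by (meson not_le)
    then show "\<exists>g\<in>carrier ?H. \<forall>n\<in>{\<one>\<^bsub>?H\<^esub>}. l < word_length ?H T (n \<otimes>\<^bsub>?H\<^esub> g)"
      using H.l_one[of a] by (intro bexI[of _ a]) auto
  qed (use T' in auto)
  then obtain a where a: "\<And>l. a l \<in> N" "\<And>l. word_length ?H T (a l) = l" by metis
  \<comment> \<open>Elements of length \<open>r j\<close>, the integer part of \<open>s j\<close>,
    stay in the precone and remain far from the base point after rescaling.\<close>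
  define r where "r j = nat \<lfloor>s j\<rfloor>" for j
  have r: "real (r j) \<le> s j" "s j - 1 \<le> real (r j)" for j
    using s_pos[of j] unfolding r_def by linarith+
  have gP: "(\<lambda>j. g (r j)) \<in> P"
    using g r by (intro preconeI[of _ 1]) auto
  have aP: "(\<lambda>j. a (r j)) \<in> P"
  proof (rule preconeI[of _ k])
    fix j
    have "real (word_length G S (a (r j))) \<le> real (k * r j)"
      using len(1)[OF a(1), of "r j"] a(2) by (simp only: of_nat_le_iff)
    also have "\<dots> \<le> k * s j" unfolding of_nat_mult using r by (intro mult_left_mono) auto
    finally show "real (word_length G S (a (r j))) \<le> k * s j" .
  qed (use a N.mem_carrier in auto)
  have g_far: "1 / 2 \<le> D (\<lambda>_. \<one>\<^bsub>G\<^esub>) (\<lambda>j. g (r j))"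
  proof (rule D_one_lower_bound[OF gP])
    show "eventually (\<lambda>j. 1 / 2 * s j \<le> word_length G S (g (r j))) \<omega>"
      \<comment> \<open>Once \<open>s j \<ge> 2\<close>, rounding loses at most half of
        \<open>s j\<close>.\<close>
      using eventually_s_ge[of 2]
    proof eventually_elim
      case (elim j)
      then show ?case using r(2)[of j] by (simp add: g)
    qed
  qed
  \<comment> \<open>The extra factor \<open>k\<close> converts the \<open>T\<close>-length
    \<open>r j\<close> into a lower bound for the \<open>S\<close>-length.\<close>
  have a_far: "1 / (2 * k) \<le> D (\<lambda>_. \<one>\<^bsub>G\<^esub>) (\<lambda>j. a (r j))"
  proof (rule D_one_lower_bound[OF aP])
    show "eventually (\<lambda>j. 1 / (2 * k) * s j \<le> word_length G S (a (r j))) \<omega>"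
      using eventually_s_ge[of 2]
    proof eventually_elim
      case (elim j)
      have "s j / 2 \<le> real (r j)" using r(2)[of j] elim by simp
      also have "\<dots> \<le> real (k * word_length G S (a (r j)))"
        using len(2)[OF a(1), of "r j"] a(2) by (simp only: of_nat_le_iff)
      finally show ?case using k by (simp add: field_simps)
    qed
  qed
  have "(\<lambda>j. a (r j)) \<in> P\<^sub>N" using aP a by (simp add: P\<^sub>N_def)
  then have "D (\<lambda>_. \<one>\<^bsub>G\<^esub>) (\<lambda>j. g (r j)) \<le> 0 \<or> D (\<lambda>_. \<one>\<^bsub>G\<^esub>) (\<lambda>j. a (r j)) \<le> 0"
    using g by (intro normal_subgroup_cone_dichotomy[OF tree gP]) auto
  moreover have "0 < 1 / (2 * real k)" using k by simp
  ultimately show False using g_far a_far by linarith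
qed

end
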